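(* There is a constant $c>0$ such that $\tau_{\pm1}(d)\ge (cd)^{d/4}$ for all $d$ that are powers of $2$.
   Context: For an integer $d\ge1$, a sequence $v_1,\dots,v_t$ ($t\ge 2$) of vectors in $[-1,1]^d$ is called minimal if (i) $v_1+\dots+v_t\in[-1,1]^d$, and (ii) for every index set $S\subset\{1,\dots,t\}$ with $2\le |S|<t$, the sum $\sum_{i\in S}v_i$ lies outside $[-1,1]^d$. Let $\tau_{\pm1}(d)$ denote the largest $t$ for which there exists a minimal sequence of length $t$ all of whose vectors lie in $\{-1,+1\}^d$. *)

theory Defs
  imports Complex_Main
begin

text \<open>Vectors in R^d are represented as functions nat => real, only coordinates k < d matter.
  A sequence v_1..v_t is represented as v :: nat => nat => real with indices 0..<t.\<close>

definition in_cube :: "nat \<Rightarrow> (nat \<Rightarrow> real) \<Rightarrow> bool" where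
  "in_cube d x \<longleftrightarrow> (\<forall>k<d. \<bar>x k\<bar> \<le> 1)"

definition minimal_seq :: "nat \<Rightarrow> nat \<Rightarrow> (nat \<Rightarrow> nat \<Rightarrow> real) \<Rightarrow> bool" where
  "minimal_seq d t v \<longleftrightarrow>
     t \<ge> 2 \<and> (\<forall>i<t. in_cube d (v i)) \<and>
     in_cube d (\<lambda>k. \<Sum>i<t. v i k) \<and>
     (\<forall>S. S \<subseteq> {..<t} \<and> 2 \<le> card S \<and> card S < t \<longrightarrow> \<not> in_cube d (\<lambda>k. \<Sum>i\<in>S. v i k))"

definition tau_pm1 :: "nat \<Rightarrow> nat" where
  "tau_pm1 d = Sup {t. \<exists>v. minimal_seq d t v \<and> (\<forall>i<t. \<forall>k<d. v i k \<in> {-1, 1})}"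

end

theory Submission
  imports Defs "HOL-Library.Infinite_Set" "HOL-Library.Nat_Bijection"
begin

text \<open>
  Let n = 2^m and d = 2n, and index coordinates and characters by the subsets of {..<m}. Suppose
  \<open>\<plusminus>1\<close> vectors f_A in dimension n satisfy a nontrivial integer linear relation, and every such
  relation has l1-norm at least L. After sign changes there is a relation with nonnegative
  coefficients. The vectors (f_A, h_A) and (f_A, -h_A), with h_A the rows of a Hadamard matrix, then
  have no subsum in the cube of length between 2 and L - 1: by Parseval both vectors of each pair
  occur equally often, up to one exception, and a parity argument turns any such subsum into a
  relation among the f_A. A shortest subsum of length at least 2 in the cube is a minimal sequence.

  For the f_A, order the subsets by their binary codes and let f_A be a character of the preceding
  set J, flipped on a subcube of density 2^(-|A|). Its Fourier transform is supported on sets up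
  to A, is close to 1 at J and equals -2^(1-|A|) at A. Hence in any linear relation the coefficient
  grows by a factor of about 2^|A| from A to J (Hastad's ill-conditioned matrices), and the product
  of these factors is about 2^(mn/2) = n^(n/2).

  As the supremum of an infinite set of naturals is unspecified, boundedness of the lengths is also
  required; it follows from Dickson's lemma applied to the multiplicities of the sign patterns.
\<close>

subsection \<open>Lengths of minimal sign sequences\<close>

text \<open>Some subsequence is monotone; if it decreases, it reaches its least value and stays
  there, so a tail of it is constant.\<close>

lemma nat_seq_incseq_subseq:
  fixes x :: "nat \<Rightarrow> nat"
  shows "\<exists>r. strict_mono r \<and> incseq (x \<circ> r)"
proof -
  obtain r where r: "strict_mono r" "monoseq (\<lambda>n. x (r n))"
    using seq_monosub[of x] by blast
  show ?thesis
  proof (cases "incseq (\<lambda>n. x (r n))")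
    case True
    then show ?thesis using r(1) by (auto simp: o_def)
  next
    case False
    then have dec: "decseq (\<lambda>n. x (r n))" using r(2) by (simp add: monoseq_iff)
    obtain N where N: "\<And>n. x (r N) \<le> x (r n)"
      using ex_has_least_nat[of "\<lambda>_. True" 0 "\<lambda>n. x (r n)"] by auto
    have "x (r (n + N)) = x (r N)" for n
      using N decseqD[OF dec, of N "n + N"] by (simp add: le_antisym)
    then have "incseq (x \<circ> (\<lambda>n. r (n + N)))" by (simp add: incseq_def)
    moreover have "strict_mono (\<lambda>n. r (n + N))"
      using r(1) by (simp add: strict_mono_def)
    ultimately show ?thesis by blast
  qed
qed

text \<open>Dickson's lemma in subsequence form: one refinement per element of \<open>F\<close>, and
  a further refinement keeps the monotonicity already gained.\<close>

lemma dickson_subseq: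
  fixes g :: "nat \<Rightarrow> 'a \<Rightarrow> nat"
  assumes "finite F"
  shows "\<exists>r. strict_mono r \<and> (\<forall>S\<in>F. incseq (\<lambda>n. g (r n) S))"
  using assms
proof (induction F rule: finite_induct)
  case empty
  show ?case using strict_mono_id by auto
next
  case (insert S F)
  then obtain r where r: "strict_mono r" "\<forall>S\<in>F. incseq (\<lambda>n. g (r n) S)" by blast
  obtain q where q: "strict_mono q" "incseq ((\<lambda>n. g (r n) S) \<circ> q)"
    using nat_seq_incseq_subseq by blast
  have "strict_mono (r \<circ> q)" using r(1) q(1) by (rule strict_mono_o)
  moreover have "incseq (\<lambda>n. g ((r \<circ> q) n) S')" if "S' \<in> insert S F" for S'
    using that r(2) q strict_mono_mono[OF q(1)]
    by (auto simp: incseq_def o_def mono_def)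
  ultimately show ?case by blast
qed

text \<open>Fibres over distinct values are disjoint, so the parts chosen in them do not interfere
  in the union.\<close>

lemma subset_with_fibre_cards:
  assumes "\<And>S. S \<in> F \<Longrightarrow> N S \<le> card {i \<in> I. p i = S}"
  shows "\<exists>K\<subseteq>I. \<forall>S\<in>F. card {i \<in> K. p i = S} = N S"
proof -
  have "\<exists>K. K \<subseteq> {i \<in> I. p i = S} \<and> card K = N S" if "S \<in> F" for S
    using obtain_subset_with_card_n[OF assms[OF that]] by metis
  then obtain K where K: "\<And>S. S \<in> F \<Longrightarrow> K S \<subseteq> {i \<in> I. p i = S} \<and> card (K S) = N S"
    by metis
  have "{i \<in> \<Union>(K ` F). p i = S} = K S" if "S \<in> F" for S
    using K that by fastforce
  then show ?thesis using K by (intro exI[of _ "\<Union>(K ` F)"]) fastforce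
qed

text \<open>Up to order, a sign sequence is given by the multiplicities of its sign patterns. Among
  infinitely many lengths, two have comparable multiplicities; the longer sequence then contains a
  copy of the shorter one, and this proper subsum in the cube contradicts minimality. Finiteness
  makes the \<open>Sup\<close> in \<open>tau_pm1\<close> a genuine upper bound.\<close>

lemma finite_pm1_minimal_lengths:
  "finite {t. \<exists>v. minimal_seq d t v \<and> (\<forall>i<t. \<forall>k<d. v i k \<in> {-1, 1})}" (is "finite ?T")
proof (rule ccontr)
  assume inf: "infinite ?T"
  define tt where "tt = enumerate ?T"
  have tt: "tt n \<in> ?T" for n using enumerate_in_set[OF inf] by (simp add: tt_def)
  have tt_mono: "strict_mono tt" using strict_mono_enumerate[OF inf] by (simp add: tt_def)
  have "\<forall>n. \<exists>v. minimal_seq d (tt n) v \<and> (\<forall>i<tt n. \<forall>k<d. v i k \<in> {-1, 1})"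
    using tt by blast
  then obtain v where v: "\<And>n. minimal_seq d (tt n) (v n)"
    and pm: "\<And>n i k. i < tt n \<Longrightarrow> k < d \<Longrightarrow> v n i k \<in> {-1, 1}" by metis
  define pat where "pat n i = {k. k < d \<and> v n i k = 1}" for n i
  define F where "F = Pow {..<d}"
  have finF: "finite F" by (simp add: F_def)
  have patF: "pat n i \<in> F" for n i by (auto simp: pat_def F_def)
  define sgn' where "sgn' S k = (if k \<in> S then 1 else -1 :: real)" for S :: "nat set" and k
  have vs: "v n i k = sgn' (pat n i) k" if "i < tt n" "k < d" for n i k
    using pm[OF that] that by (auto simp: pat_def sgn'_def)
  define N where "N n S = card {i \<in> {..<tt n}. pat n i = S}" for n S
  obtain r where r: "strict_mono r" "\<forall>S\<in>F. incseq (\<lambda>n. N (r n) S)"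
    using dickson_subseq[OF finF] by blast
  define a b where "a = r 0" and "b = r 1"
  have ab: "tt a < tt b" using tt_mono r(1) by (simp add: a_def b_def strict_mono_def)
  have "N a S \<le> N b S" if "S \<in> F" for S
    using r(2) that by (auto simp: incseq_def a_def b_def)
  then obtain K where K: "K \<subseteq> {..<tt b}" "\<forall>S\<in>F. card {i \<in> K. pat b i = S} = N a S"
    using subset_with_fibre_cards[of F "N a" "{..<tt b}" "pat b"]
    unfolding N_def[of b] by blast
  have finK: "finite K" using K(1) finite_subset by blast
  have fibre: "(\<Sum>i\<in>I. h (pat n i)) = (\<Sum>S\<in>F. real (card {i \<in> I. pat n i = S}) * h S)"
    if "finite I" for I n and h :: "nat set \<Rightarrow> real"
  proof -
    have "(\<Sum>i\<in>I. h (pat n i)) = (\<Sum>S\<in>F. \<Sum>i\<in>{i \<in> I. pat n i = S}. h (pat n i))"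
      by (rule sum.group[symmetric]) (use that finF patF in auto)
    also have "\<dots> = (\<Sum>S\<in>F. real (card {i \<in> I. pat n i = S}) * h S)"
      by (intro sum.cong refl) simp
    finally show ?thesis .
  qed
  \<comment> \<open>Sums of functions of the pattern depend on multiplicities only. The constant 1
    yields the length of the copy, the sign at a coordinate yields its sum.\<close>
  have eq: "(\<Sum>i\<in>K. h (pat b i)) = (\<Sum>i<tt a. h (pat a i))" for h :: "nat set \<Rightarrow> real"
    using fibre[OF finK, of h b] fibre[of "{..<tt a}" h a] K(2) by (simp add: N_def)
  have cardK: "card K = tt a" using eq[of "\<lambda>_. 1"] by simp
  have "(\<Sum>i\<in>K. v b i k) = (\<Sum>i<tt a. v a i k)" if "k < d" for k
  proof -
    have "(\<Sum>i\<in>K. v b i k) = (\<Sum>i\<in>K. sgn' (pat b i) k)"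
      using K(1) that by (intro sum.cong refl vs) auto
    also have "\<dots> = (\<Sum>i<tt a. sgn' (pat a i) k)" by (rule eq)
    also have "\<dots> = (\<Sum>i<tt a. v a i k)"
      using that by (intro sum.cong refl vs[symmetric]) auto
    finally show ?thesis .
  qed
  then have "in_cube d (\<lambda>k. \<Sum>i\<in>K. v b i k)"
    using v[of a] by (simp add: minimal_seq_def in_cube_def)
  moreover have "2 \<le> card K" "card K < tt b"
    using cardK ab v[of a] by (auto simp: minimal_seq_def)
  ultimately show False using v[of b] K(1) unfolding minimal_seq_def by blast
qed

section \<open>Lower bounds from shortest sums in the cube\<close>

lemma le_tau_pm1:
  assumes "minimal_seq d t v" "\<forall>i<t. \<forall>k<d. v i k \<in> {-1, 1}"
  shows "t \<le> tau_pm1 d"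
  unfolding tau_pm1_def
  by (rule cSup_upper) (use assms finite_pm1_minimal_lengths in auto)

text \<open>Serves the small dimensions, where the claimed bound is at most 1. The witness is the
  all-ones vector and its negative.\<close>

lemma two_le_tau_pm1: "2 \<le> tau_pm1 d"
proof (rule le_tau_pm1)
  show "minimal_seq d 2 (\<lambda>i k. if i = 0 then 1 else -1)"
    by (auto simp: minimal_seq_def in_cube_def numeral_2_eq_2)
qed auto

text \<open>A shortest sequence of at least two vectors \<open>w i\<close>, repetitions allowed,
  with sum in the cube is minimal: a proper subsum violating minimality would be shorter. The
  sequence \<open>u0\<close> shows that one exists, and \<open>long\<close> applies to it.\<close>

lemma long_minimal_seq_exists:
  fixes w :: "'i \<Rightarrow> nat \<Rightarrow> real"
    and t0 :: nat
  assumes I: "\<And>i k. i \<in> I \<Longrightarrow> k < d \<Longrightarrow> w i k \<in> {-1, 1}"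
    and u0: "2 \<le> t0" "\<forall>i<t0. u0 i \<in> I" "in_cube d (\<lambda>k. \<Sum>i<t0. w (u0 i) k)"
    and long: "\<And>t u. 2 \<le> t \<Longrightarrow> \<forall>i<t. u i \<in> I \<Longrightarrow> in_cube d (\<lambda>k. \<Sum>i<t. w (u i) k) \<Longrightarrow> L \<le> t"
  shows "L \<le> tau_pm1 d"
proof -
  define Q where "Q t \<longleftrightarrow> 2 \<le> t \<and> (\<exists>u. (\<forall>i<t. u i \<in> I) \<and> in_cube d (\<lambda>k. \<Sum>i<t. w (u i) k))" for t :: nat
  have "Q t0" using u0 by (auto simp: Q_def)
  define t where "t = (LEAST t. Q t)"
  have "Q t" unfolding t_def using \<open>Q t0\<close> by (rule LeastI)
  then obtain u where t: "2 \<le> t" and u: "\<forall>i<t. u i \<in> I" "in_cube d (\<lambda>k. \<Sum>i<t. w (u i) k)"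
    by (auto simp: Q_def)
  have "minimal_seq d t (\<lambda>i. w (u i))"
    unfolding minimal_seq_def
  proof (intro conjI allI impI)
    fix i assume "i < t"
    then show "in_cube d (w (u i))" using I u(1) by (fastforce simp: in_cube_def)
  next
    fix S assume S: "S \<subseteq> {..<t} \<and> 2 \<le> card S \<and> card S < t"
    show "\<not> in_cube d (\<lambda>k. \<Sum>i\<in>S. w (u i) k)"
    proof
      assume cube: "in_cube d (\<lambda>k. \<Sum>i\<in>S. w (u i) k)"
      have "finite S" using S finite_subset by blast
      then obtain h where h: "bij_betw h {..<card S} S"
        using ex_bij_betw_nat_finite atLeast0LessThan by metis
      have "(\<Sum>i<card S. w (u (h i)) k) = (\<Sum>i\<in>S. w (u i) k)" for k
        using sum.reindex_bij_betw[OF h] by fast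
      moreover have "\<forall>i<card S. u (h i) \<in> I"
        using h S u(1) by (auto simp: bij_betw_def)
      ultimately have "Q (card S)" using cube S unfolding Q_def
        by (intro conjI exI[of _ "u \<circ> h"]) auto
      then show False using S not_less_Least t_def by blast
    qed
  qed (use t u in auto)
  moreover have "\<forall>i<t. \<forall>k<d. w (u i) k \<in> {-1, 1}" using I u(1) by blast
  ultimately have "t \<le> tau_pm1 d" by (rule le_tau_pm1)
  then show ?thesis using long[OF t u] by simp
qed

subsection \<open>Characters and the doubling construction\<close>

text \<open>The Walsh character of \<open>U\<close> at the point \<open>X\<close>, an entry of
  Sylvester's Hadamard matrix. It is polymorphic because the doubling works over the integers and
  the Fourier transforms are real.\<close>

definition chi :: "nat set \<Rightarrow> nat set \<Rightarrow> 'a::comm_ring_1" where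
  "chi U X = (\<Prod>b\<in>X. if b \<in> U then -1 else 1)"

lemma of_int_chi [simp]: "of_int (chi U X) = chi U X"
  by (auto simp: chi_def intro!: prod.cong)

lemma chi_eq_power: "finite X \<Longrightarrow> chi U X = (-1) ^ card (U \<inter> X)"
  by (simp add: chi_def prod.If_cases Int_commute)

lemma chi_pm1: "chi U X \<in> {-1, 1 :: 'a :: comm_ring_1}"
  unfolding chi_def by (induction X rule: infinite_finite_induct) auto

lemma chi_commute: "finite U \<Longrightarrow> finite X \<Longrightarrow> chi U X = chi X U"
  by (simp add: chi_eq_power Int_commute)

lemma chi_sym_diff: "chi (sym_diff U V) X = chi U X * chi V X"
  unfolding chi_def prod.distrib[symmetric] by (intro prod.cong refl) auto

lemma chi_empty_left [simp]: "chi {} X = 1"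
  by (simp add: chi_def)

lemma sum_Pow_prod:
  fixes g :: "'b \<Rightarrow> 'a::comm_ring_1"
  assumes "finite C"
  shows "(\<Sum>S\<in>Pow C. \<Prod>b\<in>S. g b) = (\<Prod>b\<in>C. g b + 1)"
  using prod_add[OF assms, of g "\<lambda>_. 1"] by simp

text \<open>The sum factors over the coordinates, and each element of \<open>U\<close> contributes a
  factor -1 + 1.\<close>

lemma sum_chi_eq_0:
  assumes "U \<subseteq> {..<m}" "U \<noteq> {}"
  shows "(\<Sum>X\<in>Pow {..<m}. chi U X :: 'a::comm_ring_1) = 0"
  unfolding chi_def sum_Pow_prod[OF finite_lessThan]
  using assms by (intro prod_zero) auto

lemma chi_orthogonal:
  assumes "U \<subseteq> {..<m}" "V \<subseteq> {..<m}"
  shows "(\<Sum>X\<in>Pow {..<m}. chi U X * chi V X :: 'a::comm_ring_1) = (if U = V then 2 ^ m else 0)"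
proof (cases "U = V")
  case True
  then show ?thesis by (simp add: chi_sym_diff[symmetric] card_Pow)
next
  case False
  then have "sym_diff U V \<noteq> {}" "sym_diff U V \<subseteq> {..<m}" using assms by auto
  then show ?thesis using False by (simp only: chi_sym_diff[symmetric] if_False) (rule sum_chi_eq_0)
qed

text \<open>Fourier inversion, kept free of division so that it holds over the integers too.\<close>

lemma chi_coefficient:
  fixes y :: "nat set \<Rightarrow> 'a::comm_ring_1"
  assumes "U \<subseteq> {..<m}"
  shows "(\<Sum>X\<in>Pow {..<m}. (\<Sum>V\<in>Pow {..<m}. y V * chi V X) * chi U X) = 2 ^ m * y U"
proof -
  have "(\<Sum>X\<in>Pow {..<m}. (\<Sum>V\<in>Pow {..<m}. y V * chi V X) * chi U X)
      = (\<Sum>V\<in>Pow {..<m}. y V * (\<Sum>X\<in>Pow {..<m}. chi V X * chi U X))"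
    unfolding sum_distrib_right sum_distrib_left mult.assoc by (rule sum.swap)
  also have "\<dots> = (\<Sum>V\<in>Pow {..<m}. if V = U then 2 ^ m * y V else 0)"
    using assms by (intro sum.cong refl) (auto simp: chi_orthogonal)
  also have "\<dots> = 2 ^ m * y U" using assms by simp
  finally show ?thesis .
qed

lemma chi_independent:
  fixes y :: "nat set \<Rightarrow> real"
  assumes "\<And>X. X \<subseteq> {..<m} \<Longrightarrow> (\<Sum>V\<in>Pow {..<m}. y V * chi V X) = 0" "U \<subseteq> {..<m}"
  shows "y U = 0"
  using chi_coefficient[OF assms(2), of y] assms(1) by simp

lemma chi_parseval:
  fixes y :: "nat set \<Rightarrow> 'a::comm_ring_1"
  shows "(\<Sum>X\<in>Pow {..<m}. (\<Sum>V\<in>Pow {..<m}. y V * chi V X)\<^sup>2) = 2 ^ m * (\<Sum>V\<in>Pow {..<m}. (y V)\<^sup>2)"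
proof -
  have "(\<Sum>X\<in>Pow {..<m}. (\<Sum>V\<in>Pow {..<m}. y V * chi V X)\<^sup>2)
      = (\<Sum>X\<in>Pow {..<m}. \<Sum>U\<in>Pow {..<m}. y U * ((\<Sum>V\<in>Pow {..<m}. y V * chi V X) * chi U X))"
    by (simp only: power2_eq_square sum_distrib_left mult_ac)
  also have "\<dots> = (\<Sum>U\<in>Pow {..<m}. y U * (\<Sum>X\<in>Pow {..<m}. (\<Sum>V\<in>Pow {..<m}. y V * chi V X) * chi U X))"
    unfolding sum_distrib_left[of "y _"] by (rule sum.swap)
  also have "\<dots> = (\<Sum>U\<in>Pow {..<m}. y U * (2 ^ m * y U))"
    by (intro sum.cong refl) (simp only: chi_coefficient Pow_iff)
  finally show ?thesis by (simp add: sum_distrib_left power2_eq_square mult_ac)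
qed

section \<open>The doubling construction\<close>

lemma sum_squares_le_1_cases:
  fixes y :: "'b \<Rightarrow> int"
  assumes "finite P" "(\<Sum>A\<in>P. (y A)\<^sup>2) \<le> 1"
  obtains "\<forall>A\<in>P. y A = 0" | j where "j \<in> P" "\<bar>y j\<bar> = 1" "\<forall>A\<in>P - {j}. y A = 0"
proof (cases "\<forall>A\<in>P. y A = 0")
  case False
  then obtain j where j: "j \<in> P" "y j \<noteq> 0" by blast
  have s: "(y j)\<^sup>2 + (\<Sum>A\<in>P - {j}. (y A)\<^sup>2) \<le> 1"
    using assms j(1) by (simp add: sum.remove)
  have sq: "(y j)\<^sup>2 \<ge> 1" using j(2) by (simp add: int_one_le_iff_zero_less)
  have ge: "(\<Sum>A\<in>P - {j}. (y A)\<^sup>2) \<ge> 0" by (simp add: sum_nonneg)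
  have "(\<Sum>A\<in>P - {j}. (y A)\<^sup>2) = 0" "(y j)\<^sup>2 = 1" using s sq ge by linarith+
  then have "\<forall>A\<in>P - {j}. y A = 0" "\<bar>y j\<bar> = 1"
    using assms(1) by (auto simp: sum_nonneg_eq_0_iff power2_eq_1_iff)
  then show ?thesis using that(2) j(1) by blast
qed (use that in blast)

text \<open>
  The second half of the coordinates forces p = q up to an error of 1 at a single index j. If the
  total is odd, the first half says that \<open>\<Sum> r f\<close> is 0 or \<open>- f j\<close> at each point, and parity makes the
  choice the same at all points, so r or r + e_j is a linear relation.
\<close>

lemma doubled_sum_length:
  fixes f :: "nat set \<Rightarrow> nat set \<Rightarrow> int" and p q :: "nat set \<Rightarrow> int" and L :: int and m :: nat
  defines "P \<equiv> Pow {..<m}"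
  assumes f: "\<And>A X. A \<in> P \<Longrightarrow> X \<in> P \<Longrightarrow> f A X \<in> {-1, 1}"
    and rel: "\<And>c. (\<forall>A\<in>P. c A \<ge> 0) \<Longrightarrow> \<exists>A\<in>P. c A \<noteq> 0 \<Longrightarrow> \<forall>X\<in>P. (\<Sum>A\<in>P. c A * f A X) = 0
               \<Longrightarrow> L \<le> (\<Sum>A\<in>P. c A)"
    and nonneg: "\<And>A. A \<in> P \<Longrightarrow> p A \<ge> 0" "\<And>A. A \<in> P \<Longrightarrow> q A \<ge> 0"
    and len: "2 \<le> (\<Sum>A\<in>P. p A + q A)"
    and first: "\<And>X. X \<in> P \<Longrightarrow> \<bar>\<Sum>A\<in>P. (p A + q A) * f A X\<bar> \<le> 1"
    and second: "\<And>X. X \<in> P \<Longrightarrow> \<bar>\<Sum>A\<in>P. (p A - q A) * chi A X\<bar> \<le> 1"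
  shows "L \<le> (\<Sum>A\<in>P. p A + q A)"
proof -
  have fin: "finite P" by (simp add: P_def)
  \<comment> \<open>Each of the \<open>2 ^ m\<close> points contributes at most 1 to the Parseval
    sum, so the squares of the integers \<open>p A - q A\<close> add up to at most 1.\<close>
  have "2 ^ m * (\<Sum>A\<in>P. (p A - q A)\<^sup>2) = (\<Sum>X\<in>P. (\<Sum>A\<in>P. (p A - q A) * chi A X)\<^sup>2)"
    unfolding P_def by (rule chi_parseval[symmetric])
  also have "\<dots> \<le> (\<Sum>X\<in>P. 1)"
    using second by (intro sum_mono) (simp add: abs_square_le_1)
  also have "\<dots> = 2 ^ m * 1" by (simp add: P_def card_Pow)
  finally have le1: "(\<Sum>A\<in>P. (p A - q A)\<^sup>2) \<le> 1"
    by (subst (asm) mult_le_cancel_left_pos) auto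
  define r where "r A = min (p A) (q A)" for A
  have r0: "\<forall>A\<in>P. r A \<ge> 0" using nonneg by (auto simp: r_def)
  define g where "g X = (\<Sum>A\<in>P. r A * f A X)" for X
  from fin le1 show ?thesis
  proof (cases rule: sum_squares_le_1_cases)
    case 1
    then have pq: "p A + q A = 2 * r A" if "A \<in> P" for A using that by (auto simp: r_def)
    have "(\<Sum>A\<in>P. (p A + q A) * f A X) = 2 * g X" for X
      using pq by (simp add: g_def sum_distrib_left mult.assoc)
    then have "\<forall>X\<in>P. g X = 0" using first by fastforce
    moreover have tot: "(\<Sum>A\<in>P. p A + q A) = 2 * (\<Sum>A\<in>P. r A)"
      using pq by (simp add: sum_distrib_left)
    moreover have "\<exists>A\<in>P. r A \<noteq> 0"
    proof (rule ccontr)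
      assume "\<not> ?thesis"
      then have "(\<Sum>A\<in>P. r A) = 0" by simp
      then show False using tot len by simp
    qed
    ultimately show ?thesis using rel[of r] r0 len unfolding g_def by fastforce
  next
    case (2 j)
    have pq: "p A + q A = 2 * r A + of_bool (A = j)" if "A \<in> P" for A
      using 2 that by (cases "A = j") (auto simp: r_def)
    have j: "(\<Sum>A\<in>P. of_bool (A = j) * h A) = h j" for h :: "nat set \<Rightarrow> int"
      using 2(1) fin by (simp add: of_bool_def if_distrib[of "\<lambda>x. x * _"] cong: if_cong)
    have "(\<Sum>A\<in>P. (p A + q A) * f A X) = 2 * g X + f j X" for X
      using pq j[of "\<lambda>A. f A X"] by (simp add: g_def sum_distrib_left mult.assoc distrib_right sum.distrib)
    then have g: "\<bar>2 * g X + f j X\<bar> \<le> 1" if "X \<in> P" for X using first[OF that] by simp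
    have tot: "(\<Sum>A\<in>P. p A + q A) = 2 * (\<Sum>A\<in>P. r A) + 1"
      using pq j[of "\<lambda>_. 1"] by (simp add: sum_distrib_left sum.distrib)
    \<comment> \<open>The values of \<open>f\<close> are odd, so the parity of \<open>g X\<close> is
      that of the total of \<open>r\<close>, which does not depend on \<open>X\<close>.\<close>
    have par: "even (g X) \<longleftrightarrow> even (\<Sum>A\<in>P. r A)" if "X \<in> P" for X
    proof -
      have "g X + (\<Sum>A\<in>P. r A) = (\<Sum>A\<in>P. r A * (f A X + 1))"
        by (simp add: g_def distrib_left sum.distrib)
      also have "even \<dots>" using f that by (intro dvd_sum) fastforce
      finally show ?thesis by simp
    qed
    show ?thesis
    proof (cases "even (\<Sum>A\<in>P. r A)")
      case True
      have "\<forall>X\<in>P. g X = 0"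
      proof
        fix X assume X: "X \<in> P"
        obtain k where "g X = 2 * k" using par[OF X] True by blast
        then show "g X = 0" using g[OF X] f[OF 2(1) X] by auto
      qed
      moreover have "\<exists>A\<in>P. r A \<noteq> 0"
      proof (rule ccontr)
        assume "\<not> ?thesis"
        then have "(\<Sum>A\<in>P. r A) = 0" by simp
        then show False using tot len by simp
      qed
      ultimately have "L \<le> (\<Sum>A\<in>P. r A)" using rel[of r] r0 unfolding g_def by blast
      then show ?thesis using tot len by simp
    next
      case False
      \<comment> \<open>Here \<open>g X = - f j X\<close> at every point, so one more copy of
        \<open>j\<close> completes a relation.\<close>
      define c where "c A = r A + of_bool (A = j)" for A
      have "\<forall>X\<in>P. (\<Sum>A\<in>P. c A * f A X) = 0"
      proof
        fix X assume X: "X \<in> P"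
        obtain k where "g X = 2 * k + 1" using par[OF X] False by (auto elim: oddE)
        then have "g X = - f j X" using g[OF X] f[OF 2(1) X] by auto presburger+
        then show "(\<Sum>A\<in>P. c A * f A X) = 0"
          using j[of "\<lambda>A. f A X"] by (simp add: c_def g_def distrib_right sum.distrib)
      qed
      moreover have "\<forall>A\<in>P. c A \<ge> 0" using r0 by (auto simp: c_def)
      moreover have "\<exists>A\<in>P. c A \<noteq> 0" using r0 2(1) by (intro bexI[of _ j]) (auto simp: c_def)
      ultimately have "L \<le> (\<Sum>A\<in>P. c A)" using rel[of c] by blast
      then show ?thesis using tot len j[of "\<lambda>_. 1"] by (simp add: c_def sum.distrib)
    qed
  qed
qed

text \<open>Turns nonnegative coefficients into an actual sequence by enumerating the pairs of an
  index and a copy number.\<close>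

lemma ex_seq_with_multiplicities:
  fixes M :: "'i \<Rightarrow> nat"
  assumes "finite I"
  shows "\<exists>u :: nat \<Rightarrow> 'i. (\<forall>i<sum M I. u i \<in> I)
     \<and> (\<forall>h :: 'i \<Rightarrow> real. (\<Sum>i<sum M I. h (u i)) = (\<Sum>g\<in>I. real (M g) * h g))"
proof -
  define Z where "Z = (SIGMA g:I. {..<M g})"
  have "finite Z" "card Z = sum M I" using assms by (auto simp: Z_def)
  then obtain e where e: "bij_betw e {..<sum M I} Z"
    using ex_bij_betw_nat_finite atLeast0LessThan by metis
  have "(\<Sum>i<sum M I. h (fst (e i))) = (\<Sum>g\<in>I. real (M g) * h g)" for h :: "'i \<Rightarrow> real"
  proof -
    have "(\<Sum>i<sum M I. h (fst (e i))) = (\<Sum>z\<in>Z. h (fst z))"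
      using sum.reindex_bij_betw[OF e, of "\<lambda>z. h (fst z)"] by simp
    also have "\<dots> = (\<Sum>g\<in>I. \<Sum>_<M g. h g)"
      unfolding Z_def using assms by (subst sum.Sigma) (auto simp: case_prod_beta)
    finally show ?thesis by simp
  qed
  moreover have "\<forall>i<sum M I. fst (e i) \<in> I"
    using bij_betwE[OF e] unfolding Z_def by (metis SigmaE fst_conv lessThan_iff)
  ultimately show ?thesis by (intro exI[of _ "\<lambda>i. fst (e i)"]) simp
qed

text \<open>The given relation, made nonnegative by sign changes, supplies some sequence with sum in
  the cube. The bound \<open>rel\<close> on all relations, through
  \<open>doubled_sum_length\<close>, makes every such sequence of at least two vectors long.\<close>

lemma le_tau_pm1_doubled:
  fixes f :: "nat set \<Rightarrow> nat set \<Rightarrow> int" and L :: nat and m :: nat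
  defines "P \<equiv> Pow {..<m}"
  assumes f: "\<And>A X. A \<in> P \<Longrightarrow> X \<in> P \<Longrightarrow> f A X \<in> {-1, 1}"
    and c: "\<exists>A\<in>P. c A \<noteq> 0" "\<forall>X\<in>P. (\<Sum>A\<in>P. c A * f A X) = 0"
    and rel: "\<And>c. \<exists>A\<in>P. c A \<noteq> 0 \<Longrightarrow> \<forall>X\<in>P. (\<Sum>A\<in>P. c A * f A X) = 0
               \<Longrightarrow> int L \<le> (\<Sum>A\<in>P. \<bar>c A\<bar>)"
  shows "L \<le> tau_pm1 (2 * 2 ^ m)"
proof -
  have fin: "finite P" and card: "card P = 2 ^ m" by (auto simp: P_def card_Pow)
  obtain e where e: "bij_betw e {..<(2::nat) ^ m} P"
    using ex_bij_betw_nat_finite[OF fin] card atLeast0LessThan by metis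
  have eP: "e k \<in> P" if "k < 2 ^ m" for k using bij_betwE[OF e] that by auto
  have eP_inv: "\<exists>k<2 ^ m. e k = X" if "X \<in> P" for X
    using e that by (auto simp: bij_betw_def)
  define s where "s A = (if c A < 0 then -1 else 1 :: int)" for A
  have cs: "\<bar>c A\<bar> * s A = c A" for A by (auto simp: s_def)
  define f' where "f' A X = s A * f A X" for A X
  have f': "f' A X \<in> {-1, 1}" if "A \<in> P" "X \<in> P" for A X
    using f[OF that] by (auto simp: f'_def s_def)
  define \<sigma> where "\<sigma> b = (if b then 1 else -1 :: real)" for b
  \<comment> \<open>The first \<open>2 ^ m\<close> coordinates carry the sign-corrected function,
    the others the character with the sign chosen by \<open>b\<close>; \<open>e\<close> enumerates
    the points in both halves.\<close>
  define w where "w = (\<lambda>(A, b) k. if k < 2 ^ m then real_of_int (f' A (e k)) else \<sigma> b * chi A (e (k - 2 ^ m)))"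
  define I where "I = P \<times> (UNIV :: bool set)"
  have finI: "finite I" using fin by (simp add: I_def)
  have sumI: "(\<Sum>z\<in>I. h z) = (\<Sum>A\<in>P. h (A, True) + h (A, False))" for h :: "_ \<Rightarrow> 'b::comm_monoid_add"
    by (simp add: I_def sum.cartesian_product[symmetric, of "\<lambda>A b. h (A, b)", simplified] UNIV_bool add.commute)
  \<comment> \<open>Both vectors of a pair occur equally often: the characters cancel, and the first
    half is twice the given relation.\<close>
  define M where "M = (\<lambda>(A, b :: bool). nat \<bar>c A\<bar>)"
  obtain u where u: "\<forall>i<sum M I. u i \<in> I"
    "\<And>h :: _ \<Rightarrow> real. (\<Sum>i<sum M I. h (u i)) = (\<Sum>z\<in>I. real (M z) * h z)"
    using ex_seq_with_multiplicities[OF finI, of M] by metis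
  show ?thesis
  proof (rule long_minimal_seq_exists[where I = I and w = w and ?u0.0 = u])
    fix i and k :: nat assume i: "i \<in> I" and k: "k < 2 * 2 ^ m"
    obtain A b where i': "i = (A, b)" "A \<in> P" using i by (auto simp: I_def)
    show "w i k \<in> {-1, 1}"
      using f'[OF i'(2) eP[of k]] chi_pm1[of A "e (k - 2 ^ m)", where 'a=real] i'
      by (auto simp: w_def \<sigma>_def)
  next
    obtain A where A: "A \<in> P" "c A \<noteq> 0" using c(1) by blast
    have "1 \<le> nat \<bar>c A\<bar>" using A(2) by linarith
    also have "\<dots> \<le> (\<Sum>A\<in>P. nat \<bar>c A\<bar>)" using A(1) fin by (intro member_le_sum) auto
    finally show "2 \<le> sum M I" unfolding sumI by (simp add: M_def sum.distrib)
    show "\<forall>i<sum M I. u i \<in> I" by (rule u)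
    show "in_cube (2 * 2 ^ m) (\<lambda>k. \<Sum>i<sum M I. w (u i) k)"
      unfolding in_cube_def
    proof (intro allI impI)
      fix k :: nat assume "k < 2 * 2 ^ m"
      have "(\<Sum>i<sum M I. w (u i) k)
          = (\<Sum>A\<in>P. real_of_int \<bar>c A\<bar> * (w (A, True) k + w (A, False) k))"
        by (subst u(2)[of "\<lambda>z. w z k"], subst sumI) (simp add: M_def distrib_left)
      also have "\<dots> = 0"
      proof (cases "k < 2 ^ m")
        case True
        have "(\<Sum>A\<in>P. real_of_int \<bar>c A\<bar> * (w (A, True) k + w (A, False) k))
            = of_int (2 * (\<Sum>A\<in>P. (\<bar>c A\<bar> * s A) * f A (e k)))"
          unfolding sum_distrib_left of_int_sum using True
          by (intro sum.cong refl) (simp add: w_def f'_def)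
        then show ?thesis unfolding cs using c(2) eP[OF True] by simp
      qed (simp add: w_def \<sigma>_def)
      finally show "\<bar>\<Sum>i<sum M I. w (u i) k\<bar> \<le> 1" by simp
    qed
  next
    fix t :: nat and u :: "nat \<Rightarrow> nat set \<times> bool"
    assume t: "2 \<le> t" and u: "\<forall>i<t. u i \<in> I" and cube: "in_cube (2 * 2 ^ m) (\<lambda>k. \<Sum>i<t. w (u i) k)"
    define n where "n z = int (card {i \<in> {..<t}. u i = z})" for z
    have count: "(\<Sum>i<t. h (u i)) = (\<Sum>A\<in>P. real_of_int (n (A, True)) * h (A, True)
        + real_of_int (n (A, False)) * h (A, False))" for h :: "_ \<Rightarrow> real"
    proof -
      have "(\<Sum>i<t. h (u i)) = (\<Sum>z\<in>I. \<Sum>i\<in>{i \<in> {..<t}. u i = z}. h (u i))"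
        by (rule sum.group[symmetric]) (use u finI in auto)
      also have "\<dots> = (\<Sum>z\<in>I. real_of_int (n z) * h z)"
        by (intro sum.cong refl) (simp add: n_def)
      finally show ?thesis unfolding sumI .
    qed
    have tot: "int t = (\<Sum>A\<in>P. n (A, True) + n (A, False))"
    proof -
      have "real_of_int (int t) = of_int (\<Sum>A\<in>P. n (A, True) + n (A, False))"
        using count[of "\<lambda>_. 1"] by simp
      then show ?thesis by (simp only: of_int_eq_iff)
    qed
    have "int L \<le> (\<Sum>A\<in>P. n (A, True) + n (A, False))"
    proof (rule doubled_sum_length[of m f', folded P_def])
      fix A X assume "A \<in> P" "X \<in> P"
      then show "f' A X \<in> {-1, 1}" by (rule f')
    next
      fix d :: "nat set \<Rightarrow> int"
      assume d: "\<forall>A\<in>P. 0 \<le> d A" "\<exists>A\<in>P. d A \<noteq> 0" "\<forall>X\<in>P. (\<Sum>A\<in>P. d A * f' A X) = 0"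
      \<comment> \<open>Undoing the sign changes turns \<open>d\<close> into a relation among the
        original functions with the same l1-norm.\<close>
      have "int L \<le> (\<Sum>A\<in>P. \<bar>d A * s A\<bar>)"
        using d(2,3) by (intro rel) (auto simp: f'_def mult.assoc s_def)
      also have "\<dots> = (\<Sum>A\<in>P. d A)"
        using d(1) by (intro sum.cong refl) (auto simp: abs_mult s_def)
      finally show "int L \<le> (\<Sum>A\<in>P. d A)" .
    next
      fix X assume "X \<in> P"
      then obtain k where k: "k < 2 ^ m" "e k = X" using eP_inv by blast
      have "(\<Sum>i<t. w (u i) k) = real_of_int (\<Sum>A\<in>P. (n (A, True) + n (A, False)) * f' A X)"
        unfolding count[of "\<lambda>z. w z k"] using k by (simp add: w_def algebra_simps)
      moreover have "\<bar>\<Sum>i<t. w (u i) k\<bar> \<le> 1"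
        using cube k(1) by (auto simp: in_cube_def)
      ultimately show "\<bar>\<Sum>A\<in>P. (n (A, True) + n (A, False)) * f' A X\<bar> \<le> 1"
        by (simp only: of_int_abs[symmetric] of_int_le_1_iff)
      have "(\<Sum>i<t. w (u i) (k + 2 ^ m)) = real_of_int (\<Sum>A\<in>P. (n (A, True) - n (A, False)) * chi A X)"
        unfolding count[of "\<lambda>z. w z (k + 2 ^ m)"] using k by (simp add: w_def \<sigma>_def algebra_simps)
      moreover have "\<bar>\<Sum>i<t. w (u i) (k + 2 ^ m)\<bar> \<le> 1"
        using cube k(1) by (auto simp: in_cube_def)
      ultimately show "\<bar>\<Sum>A\<in>P. (n (A, True) - n (A, False)) * chi A X\<bar> \<le> 1"
        by (simp only: of_int_abs[symmetric] of_int_le_1_iff)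
    qed (use t tot in \<open>auto simp: n_def\<close>)
    then show "L \<le> t" using tot by simp
  qed
qed

subsection \<open>Ill-conditioned systems of Boolean functions\<close>

text \<open>Above \<open>t\<close> every bit of \<open>U\<close> is one of \<open>B\<close>, and the
  bits of \<open>U\<close> below \<open>t\<close> total less than the bit \<open>t\<close> that
  \<open>U\<close> lacks.\<close>

lemma set_encode_less:
  assumes "finite B" "finite U" "t \<in> B" "t \<notin> U" "\<And>b. b \<in> U \<Longrightarrow> t < b \<Longrightarrow> b \<in> B"
  shows "set_encode U < set_encode B"
proof -
  have U: "U = {b \<in> U. b < t} \<union> {b \<in> U. t < b}" using assms(4) by (auto simp: not_less_iff_gr_or_eq)
  have "set_encode U = (\<Sum>b\<in>{b \<in> U. b < t}. 2 ^ b) + (\<Sum>b\<in>{b \<in> U. t < b}. 2 ^ b)"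
    unfolding set_encode_def by (subst U, rule sum.union_disjoint) (use assms(2) in auto)
  also have "(\<Sum>b\<in>{b \<in> U. b < t}. 2 ^ b) \<le> (\<Sum>b<t. 2 ^ b :: nat)"
    by (rule sum_mono2) auto
  also have "\<dots> < 2 ^ t" by (induction t) auto
  also have "(\<Sum>b\<in>{b \<in> U. t < b}. 2 ^ b) \<le> (\<Sum>b\<in>B - {t}. 2 ^ b :: nat)"
    by (rule sum_mono2) (use assms in auto)
  also have "2 ^ t + (\<Sum>b\<in>B - {t}. 2 ^ b :: nat) = set_encode B"
    unfolding set_encode_def using assms by (simp add: sum.remove)
  finally show ?thesis by simp
qed

text \<open>The witness is the highest bit where the sets differ; if it lay in \<open>J\<close>, the
  order of the codes would be reversed.\<close>

lemma set_encode_less_obtain: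
  assumes "finite B" "finite J" "set_encode J < set_encode B"
  obtains t where "t \<in> B" "t \<notin> J" "\<And>b. t < b \<Longrightarrow> b \<in> J \<longleftrightarrow> b \<in> B"
proof -
  define D where "D = sym_diff J B"
  have "finite D" "D \<noteq> {}" using assms by (auto simp: D_def)
  then have t: "Max D \<in> D" and above: "\<And>b. Max D < b \<Longrightarrow> b \<notin> D" by (auto dest: Max_ge)
  have "Max D \<notin> J"
  proof
    assume J: "Max D \<in> J"
    then have "Max D \<notin> B" using t by (auto simp: D_def)
    then have "set_encode B < set_encode J"
      using J above assms by (intro set_encode_less[of J B "Max D"]) (auto simp: D_def)
    then show False using assms(3) by simp
  qed
  then show ?thesis using t above by (intro that[of "Max D"]) (auto simp: D_def)
qed

section \<open>Flipping a character on a subcube\<close>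

text \<open>Up to scale, this is the Fourier expansion of the indicator of the subcube of points
  disjoint from \<open>C\<close>.\<close>

lemma sum_chi_Pow:
  assumes "finite C" "finite X"
  shows "(\<Sum>S\<in>Pow C. chi S X :: 'a::comm_ring_1) = (if C \<inter> X = {} then 2 ^ card C else 0)"
proof -
  have "(\<Sum>S\<in>Pow C. chi S X :: 'a) = (\<Sum>S\<in>Pow C. chi X S)"
    using assms by (intro sum.cong refl chi_commute) (auto intro: finite_subset)
  also have "\<dots> = (\<Prod>b\<in>C. (if b \<in> X then -1 else 1) + 1)"
    unfolding chi_def by (rule sum_Pow_prod[OF assms(1)])
  also have "\<dots> = (if C \<inter> X = {} then 2 ^ card C else 0)"
  proof (cases "C \<inter> X = {}")
    case True
    then have "(\<Prod>b\<in>C. (if b \<in> X then -1 else 1) + 1) = (\<Prod>b\<in>C. 2 :: 'a)"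
      by (intro prod.cong refl) (auto simp: disjoint_iff)
    then show ?thesis using True by simp
  next
    case False
    then show ?thesis using assms(1) by (auto intro!: prod_zero)
  qed
  finally show ?thesis .
qed

text \<open>
  The function is chi J with its sign flipped on the subcube E where chi (sym_diff J B) = 1 and all
  bits of B other than the leading bit t of sym_diff J B vanish. Flipping on E perturbs the Fourier
  coefficients by 2 / 2 ^ card B on an affine space whose largest element in binary order is B.
\<close>

lemma spike_function:
  fixes J B :: "nat set"
  assumes "finite B" "finite J" "set_encode J < set_encode B"
  defines "\<epsilon> \<equiv> 2 / 2 ^ card B :: real"
  obtains F :: "nat set \<Rightarrow> real" where
    "\<And>U. F U \<noteq> 0 \<Longrightarrow> U \<subseteq> J \<union> B \<and> set_encode U \<le> set_encode B"
    "F B = - \<epsilon>" "F J = 1 - \<epsilon>" "\<And>U. U \<noteq> J \<Longrightarrow> \<bar>F U\<bar> \<le> \<epsilon>" "\<And>U. F U \<in> \<rat>"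
    "\<And>X M. finite X \<Longrightarrow> finite M \<Longrightarrow> J \<union> B \<subseteq> M \<Longrightarrow> (\<Sum>U\<in>Pow M. F U * chi U X) \<in> {-1, 1}"
proof -
  obtain t where t: "t \<in> B" "t \<notin> J" "\<And>b. t < b \<Longrightarrow> b \<in> J \<longleftrightarrow> b \<in> B"
    using set_encode_less_obtain[OF assms(1-3)] by blast
  define C where "C = B - {t}"
  have C: "finite C" "card B = Suc (card C)" using assms(1) t(1)
    by (auto simp: C_def card_Suc_Diff1 simp del: card_Diff_insert)
  \<comment> \<open>The cosets of \<open>J\<close> and \<open>B\<close> modulo the subsets of
    \<open>C\<close>. The bit \<open>t\<close> separates them: it lies in every member of \<B> and
    in none of \<A>.\<close>
  define \<A> where "\<A> = sym_diff J ` Pow C"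
  define \<B> where "\<B> = sym_diff B ` Pow C"
  have disj: "\<A> \<inter> \<B> = {}" using t by (auto simp: \<A>_def \<B>_def C_def)
  have fin: "finite \<A>" "finite \<B>" using C(1) by (auto simp: \<A>_def \<B>_def)
  have inj: "inj_on (sym_diff Z) (Pow C)" for Z by (intro inj_onI) blast
  define F where "F U = of_bool (U = J) - \<epsilon> * of_bool (U \<in> \<A> \<union> \<B>)" for U
  have sub: "\<A> \<union> \<B> \<subseteq> Pow (J \<union> B)" by (auto simp: \<A>_def \<B>_def C_def)
  have JA: "J \<in> \<A>" and BB: "B \<in> \<B>"
    unfolding \<A>_def \<B>_def by (rule image_eqI[of _ _ "{}"]; simp)+
  have encA: "set_encode U < set_encode B" if U: "U \<in> \<A>" for U
  proof -
    obtain S where "U = sym_diff J S" "S \<in> Pow C" using U unfolding \<A>_def by (rule imageE)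
    then have S: "S \<subseteq> C" "U = sym_diff J S" by blast+
    have "finite S" using S(1) C(1) by (rule finite_subset)
    then have "finite U" using S(2) assms(2) by simp
    moreover have "t \<notin> U" using S t(2) by (auto simp: C_def)
    moreover have "b \<in> B" if "b \<in> U" "t < b" for b
      using that S t(3)[of b] by (auto simp: C_def)
    ultimately show ?thesis using assms(1) t(1) by (intro set_encode_less[of B U t])
  qed
  have encB: "set_encode U \<le> set_encode B" if "U \<in> \<B>" for U
  proof -
    have "U \<subseteq> B" using that by (auto simp: \<B>_def C_def)
    then show ?thesis unfolding set_encode_def using assms(1) by (intro sum_mono2) auto
  qed
  show thesis
  proof (rule that[of F])
    show "U \<subseteq> J \<union> B \<and> set_encode U \<le> set_encode B" if "F U \<noteq> 0" for U
    proof -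
      have "U \<in> \<A> \<union> \<B>" using that JA by (cases "U = J") (auto simp: F_def)
      then show ?thesis using sub encA encB by (auto dest: less_imp_le)
    qed
    show "F B = - \<epsilon>" using BB t by (auto simp: F_def)
    show "F J = 1 - \<epsilon>" using JA by (simp add: F_def)
    show "\<bar>F U\<bar> \<le> \<epsilon>" if "U \<noteq> J" for U using that by (auto simp: F_def \<epsilon>_def)
    show "F U \<in> \<rat>" for U by (auto simp: F_def \<epsilon>_def of_bool_def)
    fix X M :: "nat set" assume X: "finite X" and M: "finite M" "J \<union> B \<subseteq> M"
    define \<Sigma> where "\<Sigma> = (\<Sum>S\<in>Pow C. chi S X :: real)"
    have shift: "(\<Sum>U\<in>sym_diff Z ` Pow C. chi U X) = chi Z X * \<Sigma>" for Z
      unfolding sum.reindex[OF inj] \<Sigma>_def sum_distrib_left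
      by (intro sum.cong refl) (simp add: chi_sym_diff)
    have "(\<Sum>U\<in>Pow M. F U * chi U X)
        = (\<Sum>U\<in>Pow M. (if U = J then chi U X else 0) - \<epsilon> * (if U \<in> \<A> \<union> \<B> then chi U X else 0))"
      by (intro sum.cong refl) (auto simp: F_def algebra_simps)
    also have "\<dots> = (\<Sum>U\<in>Pow M. if U = J then chi U X else 0)
        - \<epsilon> * (\<Sum>U\<in>Pow M. if U \<in> \<A> \<union> \<B> then chi U X else 0)"
      by (simp only: sum_subtractf sum_distrib_left)
    also have "(\<Sum>U\<in>Pow M. if U = J then chi U X else 0 :: real) = chi J X"
      using M by simp
    also have "(\<Sum>U\<in>Pow M. if U \<in> \<A> \<union> \<B> then chi U X else 0 :: real) = (\<Sum>U\<in>\<A> \<union> \<B>. chi U X)"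
    proof -
      have "Pow M \<inter> (\<A> \<union> \<B>) = \<A> \<union> \<B>" using M(2) sub by blast
      then show ?thesis
        using sum.inter_restrict[of "Pow M" "\<lambda>U. chi U X :: real" "\<A> \<union> \<B>"] M(1) by simp
    qed
    also have "\<dots> = (chi J X + chi B X) * \<Sigma>"
      using fin disj by (simp add: sum.union_disjoint shift[symmetric] distrib_right \<A>_def \<B>_def)
    finally have eq: "(\<Sum>U\<in>Pow M. F U * chi U X) = chi J X - \<epsilon> * ((chi J X + chi B X) * \<Sigma>)" .
    \<comment> \<open>As \<open>card B = card C + 1\<close>, the scale \<epsilon> is the inverse of
      \<open>2 ^ card C\<close>. The value is thus \<open>- chi B X\<close> on the points disjoint
      from \<open>C\<close> and \<open>chi J X\<close> elsewhere.\<close>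
    have \<Sigma>: "\<Sigma> = 0 \<or> \<epsilon> * \<Sigma> = 1"
      using C unfolding \<Sigma>_def sum_chi_Pow[OF C(1) X] by (auto simp: \<epsilon>_def)
    have "chi J X \<in> {-1, 1 :: real}" "chi B X \<in> {-1, 1 :: real}" by (rule chi_pm1)+
    then show "(\<Sum>U\<in>Pow M. F U * chi U X) \<in> {-1, 1}"
      unfolding eq using \<Sigma> by (auto simp: algebra_simps)
  qed
qed

section \<open>Linear algebra: growth, triangular systems, denominators\<close>

text \<open>Weigh the coefficients as \<open>a q = \<bar>c q\<bar> * (2 / 2 ^ k q)\<close>. In the
  equation at \<open>Suc p\<close> the entry near 1 contributes
  \<open>a p * (2 ^ (k p - 1) - 1)\<close>, the earlier ones at most their total weight, which is at
  most \<open>a p\<close> by induction. So \<open>a (Suc p)\<close> is at least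
  \<open>a p * (2 ^ (k p - 1) - 2)\<close>, hence at least \<open>a p * 2 ^ (k p - 2)\<close> as
  \<open>3 \<le> k p\<close>. The second conjunct survives because each weight at least
  doubles.\<close>

lemma coefficient_growth:
  fixes c :: "nat \<Rightarrow> real" and G :: "nat \<Rightarrow> nat \<Rightarrow> real" and k :: "nat \<Rightarrow> nat"
  assumes k: "\<And>p. p < N \<Longrightarrow> 3 \<le> k p"
    and diag: "\<And>p. p < N \<Longrightarrow> \<bar>G p p\<bar> = 2 / 2 ^ k p"
    and sub: "\<And>p. Suc p < N \<Longrightarrow> G p (Suc p) = 1 - 2 / 2 ^ k p"
    and small: "\<And>p q. q < p \<Longrightarrow> Suc p < N \<Longrightarrow> \<bar>G q (Suc p)\<bar> \<le> 2 / 2 ^ k q"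
    and eq: "\<And>p. Suc p < N \<Longrightarrow> (\<Sum>q\<le>Suc p. c q * G q (Suc p)) = 0"
    and start: "1 \<le> \<bar>c 0 * G 0 0\<bar>"
    and p: "p < N"
  shows "(\<Prod>q<p. 2 ^ (k q - 2)) \<le> \<bar>c p\<bar> * (2 / 2 ^ k p) \<and>
         (\<Sum>q<p. \<bar>c q\<bar> * (2 / 2 ^ k q)) \<le> \<bar>c p\<bar> * (2 / 2 ^ k p)"
  using p
proof (induction p)
  case 0
  then show ?case using start diag[OF 0] by (simp add: abs_mult)
next
  case (Suc p)
  define a where "a q = \<bar>c q\<bar> * (2 / 2 ^ k q)" for q
  have IH: "(\<Prod>q<p. 2 ^ (k q - 2)) \<le> a p" "(\<Sum>q<p. a q) \<le> a p"
    using Suc by (simp_all add: a_def)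
  have kp: "3 \<le> k p" using k Suc.prems by simp
  have a0: "a p \<ge> 0" by (simp add: a_def)
  have "c (Suc p) * G (Suc p) (Suc p) + c p * G p (Suc p) + (\<Sum>q<p. c q * G q (Suc p)) = 0"
    using eq[OF Suc.prems] by (simp add: lessThan_Suc_atMost[symmetric] add_ac)
  then have "\<bar>c p * G p (Suc p)\<bar> \<le> \<bar>c (Suc p) * G (Suc p) (Suc p)\<bar> + \<bar>\<Sum>q<p. c q * G q (Suc p)\<bar>"
    by linarith
  also have "\<bar>c (Suc p) * G (Suc p) (Suc p)\<bar> = a (Suc p)"
    using diag[OF Suc.prems] by (simp add: abs_mult a_def)
  also have "\<bar>\<Sum>q<p. c q * G q (Suc p)\<bar> \<le> (\<Sum>q<p. a q)"
    unfolding a_def using small Suc.prems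
    by (intro order_trans[OF sum_abs] sum_mono) (simp add: abs_mult mult_left_mono del: times_divide_eq_right)
  also note IH(2)
  also have "\<bar>c p * G p (Suc p)\<bar> = a p * (2 ^ (k p - 1) - 1)"
  proof -
    have pw: "(2::real) ^ k p = 2 * 2 ^ (k p - 1)" using kp by (cases "k p") auto
    have "(2::real) ^ k p \<ge> 2" using pw by simp
    then have "\<bar>G p (Suc p)\<bar> = 1 - 2 / 2 ^ k p" using sub[OF Suc.prems] by simp
    then have "\<bar>G p (Suc p)\<bar> = 2 / 2 ^ k p * (2 ^ (k p - 1) - 1)"
      using pw by (simp add: field_simps)
    then show ?thesis by (simp add: abs_mult a_def)
  qed
  finally have step: "a p * (2 ^ (k p - 1) - 2) \<le> a (Suc p)" by (simp add: algebra_simps)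
  have pw: "(2::real) ^ (k p - 1) = 2 * 2 ^ (k p - 2)" "(2::real) ^ (k p - 2) \<ge> 2 ^ 1"
  proof -
    obtain j where j: "k p = j + 3" using kp le_Suc_ex add.commute by metis
    then show "(2::real) ^ (k p - 1) = 2 * 2 ^ (k p - 2)" by (simp add: numeral_3_eq_3 numeral_2_eq_2)
    show "(2::real) ^ (k p - 2) \<ge> 2 ^ 1" using kp by (intro power_increasing) auto
  qed
  then have "a p * 2 ^ (k p - 2) \<le> a p * (2 ^ (k p - 1) - 2)"
    using a0 by (intro mult_left_mono) auto
  then have ge: "a p * 2 ^ (k p - 2) \<le> a (Suc p)" using step by linarith
  have "2 * a p \<le> a (Suc p)" using ge a0 pw(2) mult_left_mono[of 2 "2 ^ (k p - 2)" "a p"] by simp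
  moreover have "(\<Prod>q<Suc p. 2 ^ (k q - 2)) \<le> a (Suc p)"
  proof -
    have "(\<Prod>q<p. 2 ^ (k q - 2)) * 2 ^ (k p - 2) \<le> a p * 2 ^ (k p - 2)"
      by (rule mult_right_mono[OF IH(1)]) simp
    from order_trans[OF this ge] show ?thesis by simp
  qed
  ultimately show ?case using IH by (simp add: a_def)
qed

text \<open>Elimination from the largest code downwards, by induction on a strict bound for the
  codes in the support of \<open>y\<close>. Finite sets have distinct codes, so subtracting
  \<open>y A / F A A\<close> times row \<open>A\<close> lowers the bound and keeps everything
  rational.\<close>

lemma triangular_rational_solution:
  fixes F :: "nat set \<Rightarrow> nat set \<Rightarrow> real" and y :: "nat set \<Rightarrow> real"
  assumes "finite Q" "\<And>A. A \<in> Q \<Longrightarrow> finite A"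
    and supp: "\<And>A U. A \<in> Q \<Longrightarrow> F A U \<noteq> 0 \<Longrightarrow> U \<in> Q \<and> set_encode U \<le> set_encode A"
    and diag: "\<And>A. A \<in> Q \<Longrightarrow> F A A \<noteq> 0"
    and rat: "\<And>A U. A \<in> Q \<Longrightarrow> F A U \<in> \<rat>"
    and y: "\<And>U. y U \<in> \<rat>" "\<And>U. y U \<noteq> 0 \<Longrightarrow> U \<in> Q"
  shows "\<exists>c. (\<forall>A. c A \<in> \<rat>) \<and> (\<forall>U. y U = (\<Sum>A\<in>Q. c A * F A U))"
proof -
  have "\<exists>c. (\<forall>A. c A \<in> \<rat>) \<and> (\<forall>U. y U = (\<Sum>A\<in>Q. c A * F A U))"
    if "\<And>U. y U \<in> \<rat>" "\<And>U. y U \<noteq> 0 \<Longrightarrow> U \<in> Q \<and> set_encode U < l" for l y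
    using that
  proof (induction l arbitrary: y)
    case 0
    then have "y U = 0" for U by fastforce
    then show ?case by (intro exI[of _ "\<lambda>_. 0"]) auto
  next
    case (Suc l)
    show ?case
    proof (cases "\<exists>A\<in>Q. set_encode A = l")
      case True
      then obtain A where A: "A \<in> Q" "set_encode A = l" by blast
      have uniq: "U = A" if "U \<in> Q" "set_encode U = l" for U
        using that A assms(2) set_encode_eq by blast
      define r where "r = y A / F A A"
      have r: "r \<in> \<rat>" using Suc.prems(1) rat[OF A(1)] by (simp add: r_def)
      define y' where "y' U = y U - r * F A U" for U
      have "\<exists>c. (\<forall>A. c A \<in> \<rat>) \<and> (\<forall>U. y' U = (\<Sum>A\<in>Q. c A * F A U))"
      proof (rule Suc.IH)
        show "y' U \<in> \<rat>" for U using Suc.prems(1) rat[OF A(1)] r by (simp add: y'_def)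
        fix U assume U: "y' U \<noteq> 0"
        then have "U \<noteq> A" using diag[OF A(1)] by (auto simp: y'_def r_def)
        moreover have "U \<in> Q \<and> set_encode U < Suc l"
        proof (cases "y U = 0")
          case True
          then have "F A U \<noteq> 0" using U by (auto simp: y'_def)
          then show ?thesis using supp[OF A(1)] A(2) by fastforce
        qed (use Suc.prems(2) in blast)
        ultimately show "U \<in> Q \<and> set_encode U < l" using uniq less_Suc_eq by blast
      qed
      then obtain c where c: "\<And>A. c A \<in> \<rat>" "\<And>U. y' U = (\<Sum>A\<in>Q. c A * F A U)" by blast
      define c' where "c' = c(A := c A + r)"
      have "y U = (\<Sum>A\<in>Q. c' A * F A U)" for U
      proof -
        have "(\<Sum>A\<in>Q. c' A * F A U) = (\<Sum>Z\<in>Q. c Z * F Z U + (if Z = A then r * F A U else 0))"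
          by (intro sum.cong refl) (auto simp: c'_def algebra_simps)
        also have "\<dots> = y U" using A(1) assms(1) by (simp add: sum.distrib c(2)[symmetric] y'_def)
        finally show ?thesis by simp
      qed
      moreover have "c' Z \<in> \<rat>" for Z using c(1) r by (simp add: c'_def)
      ultimately show ?thesis by blast
    next
      case False
      then show ?thesis using Suc.prems by (intro Suc.IH) (auto simp: less_Suc_eq)
    qed
  qed
  note * = this
  show ?thesis
  proof (rule *[of _ "Suc (Max (set_encode ` Q))"])
    show "U \<in> Q \<and> set_encode U < Suc (Max (set_encode ` Q))" if "y U \<noteq> 0" for U
      using y(2)[OF that] assms(1) by (simp add: le_imp_less_Suc)
  qed (rule y)
qed

lemma common_denominator:
  fixes c :: "'b \<Rightarrow> real"
  assumes "finite P" "\<And>A. A \<in> P \<Longrightarrow> c A \<in> \<rat>"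
  shows "\<exists>D::int. D \<noteq> 0 \<and> (\<forall>A\<in>P. of_int D * c A \<in> \<int>)"
  using assms
proof (induction P rule: finite_induct)
  case (insert B P)
  then obtain D :: int where D: "D \<noteq> 0" "\<forall>A\<in>P. of_int D * c A \<in> \<int>" by auto
  have "c B \<in> \<rat>" using insert.prems by simp
  then obtain a b :: int where "b > 0" "coprime a b" "c B = of_int a / of_int b"
    by (rule Rats_cases')
  then have ab: "c B = of_int a / of_int b" "b \<noteq> 0" by simp_all
  have "of_int (D * b) * c A \<in> \<int>" if "A \<in> P" for A
  proof -
    have "of_int (D * b) * c A = of_int b * (of_int D * c A)" by simp
    also have "\<dots> \<in> \<int>" by (rule Ints_mult[OF Ints_of_int bspec[OF D(2) that]])
    finally show ?thesis .
  qed
  moreover have "of_int (D * b) * c B = of_int (D * a)" using ab by simp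
  ultimately show ?case using D(1) ab(2) by (intro exI[of _ "D * b"]) (auto simp del: of_int_mult)
qed (auto intro: exI[of _ 1])

section \<open>Counting and ordering the subsets\<close>

text \<open>Each set is paired with its complement. This is the source of the leading term of the
  exponent.\<close>

lemma sum_card_Pow: "2 * (\<Sum>A\<in>Pow {..<m}. card A) = m * 2 ^ m"
proof -
  have "(\<Sum>A\<in>Pow {..<m}. card A) = (\<Sum>A\<in>Pow {..<m}. card ({..<m} - A))"
    by (rule sum.reindex_bij_witness[of _ "\<lambda>A. {..<m} - A" "\<lambda>A. {..<m} - A"])
      (auto simp: double_diff)
  then have "2 * (\<Sum>A\<in>Pow {..<m}. card A) = (\<Sum>A\<in>Pow {..<m}. card A + card ({..<m} - A))"
    by (simp add: sum.distrib)
  also have "\<dots> = (\<Sum>A\<in>Pow {..<m}. m)"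
  proof (intro sum.cong refl)
    fix A assume "A \<in> Pow {..<m}"
    then show "card A + card ({..<m} - A) = m"
      using card_mono[of "{..<m}" A] by (auto simp: card_Diff_subset finite_subset)
  qed
  finally show ?thesis by (simp add: card_Pow)
qed

lemma decreasing_enumeration:
  assumes "finite R" "\<And>A. A \<in> R \<Longrightarrow> finite A"
  obtains s where "bij_betw s {..<card R} R"
    "\<And>p q. p < q \<Longrightarrow> q < card R \<Longrightarrow> set_encode (s q) < set_encode (s p)"
proof -
  define xs where "xs = rev (sorted_list_of_set (set_encode ` R))"
  have inj: "inj_on set_encode R"
    by (rule inj_on_subset[OF inj_on_set_encode]) (use assms(2) in auto)
  have len: "length xs = card R" using inj by (simp add: xs_def card_image)
  have set: "set xs = set_encode ` R" using assms(1) by (simp add: xs_def)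
  have dist: "distinct xs" by (simp add: xs_def)
  have sorted: "sorted_wrt (>) xs"
    unfolding xs_def sorted_wrt_rev using strict_sorted_list_of_set by simp
  define s where "s = (\<lambda>i. set_decode (xs ! i))"
  have "bij_betw (\<lambda>i. xs ! i) {..<card R} (set_encode ` R)"
    using bij_betw_nth[OF dist, of "{..<card R}" "set_encode ` R"] len set by simp
  moreover have "bij_betw set_decode (set_encode ` R) R"
    by (rule bij_betw_byWitness[where f' = set_encode]) (use assms(2) in auto)
  ultimately have "bij_betw (set_decode \<circ> (\<lambda>i. xs ! i)) {..<card R} R" by (rule bij_betw_trans)
  then have "bij_betw s {..<card R} R" by (simp add: s_def o_def)
  moreover have "set_encode (s q) < set_encode (s p)" if "p < q" "q < card R" for p q
    using sorted_wrt_nth_less[OF sorted] that len by (simp add: s_def)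
  ultimately show ?thesis by (rule that)
qed

section \<open>The system of Boolean functions\<close>

text \<open>
  The sets s 0, s 1, \<dots> are the sets of size at least 3, in decreasing binary order and without
  the top set; F A is the Fourier transform of the Boolean function attached to A. The top set is
  spared so that its function can close the linear relation. Sets of size at most 2 only get
  characters, since the growth factor of a set of size k, roughly 2^(k-1) - 2, must be at least 2.
\<close>

locale spike_system =
  fixes m N :: nat and s :: "nat \<Rightarrow> nat set" and F :: "nat set \<Rightarrow> nat set \<Rightarrow> real"
  assumes m: "4 \<le> m"
    and bij: "bij_betw s {..<N} {A \<in> Pow {..<m} - {{..<m}}. 3 \<le> card A}"
    and decr: "\<And>p q. p < q \<Longrightarrow> q < N \<Longrightarrow> set_encode (s q) < set_encode (s p)"
    and s0: "0 < N" "s 0 = {1..<m}"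
    and top: "\<And>U. F {..<m} U = of_bool (U = {1..<m})"
    and low: "\<And>A U. A \<in> Pow {..<m} \<Longrightarrow> card A < 3 \<Longrightarrow> F A U = of_bool (U = A)"
    and supp: "\<And>A U. A \<in> Pow {..<m} - {{..<m}} \<Longrightarrow> F A U \<noteq> 0 \<Longrightarrow>
        U \<in> Pow {..<m} - {{..<m}} \<and> set_encode U \<le> set_encode A"
    and diag: "\<And>p. p < N \<Longrightarrow> F (s p) (s p) = - (2 / 2 ^ card (s p))"
    and link: "\<And>p. Suc p < N \<Longrightarrow> F (s p) (s (Suc p)) = 1 - 2 / 2 ^ card (s p)"
    and small: "\<And>p U. p < N \<Longrightarrow> (Suc p < N \<Longrightarrow> U \<noteq> s (Suc p)) \<Longrightarrow> U \<noteq> {} \<Longrightarrow> \<bar>F (s p) U\<bar> \<le> 2 / 2 ^ card (s p)"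
    and rat: "\<And>A U. F A U \<in> \<rat>"
    and bool: "\<And>A X. A \<in> Pow {..<m} \<Longrightarrow> X \<in> Pow {..<m} \<Longrightarrow> (\<Sum>U\<in>Pow {..<m}. F A U * chi U X) \<in> {-1, 1}"

lemma atLeast1_lessThan_neq: "0 < m \<Longrightarrow> {1..<m} \<noteq> {..<m::nat}"
  by (metis atLeastLessThan_iff lessThan_iff not_one_le_zero)

text \<open>Each \<open>s p\<close> receives the function of \<open>spike_function\<close> for its
  successor \<open>s (Suc p)\<close>, the next smaller set of size at least 3. The hypothesis on
  \<open>m\<close> puts \<open>{1..<m}\<close> among these sets.\<close>

lemma spike_system_exists:
  assumes m: "4 \<le> m"
  shows "\<exists>N s F. spike_system m N s F"
proof -
  let ?P = "Pow {..<m}" and ?T = "{..<m}"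
  define R where "R = {A \<in> ?P - {?T}. 3 \<le> card A}"
  have finR: "finite R" and finA: "\<And>A. A \<in> ?P \<Longrightarrow> finite A"
    by (auto simp: R_def intro: finite_subset)
  define N where "N = card R"
  obtain s where s: "bij_betw s {..<N} R"
    "\<And>p q. p < q \<Longrightarrow> q < N \<Longrightarrow> set_encode (s q) < set_encode (s p)"
    using decreasing_enumeration[OF finR] finA unfolding N_def R_def by (metis (no_types, lifting) DiffD1 mem_Collect_eq)
  have sR: "s p \<in> R" if "p < N" for p using bij_betwE[OF s(1)] that by simp
  have sinv: "\<exists>p<N. s p = A" if "A \<in> R" for A using s(1) that by (auto simp: bij_betw_def)
  have T': "insert 0 {1..<m} = ?T" using m by auto
  \<comment> \<open>The code of \<open>{1..<m}\<close> is just below that of the top set, so this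
    set comes first in the decreasing enumeration.\<close>
  have encT: "set_encode ?T = Suc (set_encode {1..<m})"
    unfolding T'[symmetric] by (subst set_encode_insert) auto
  have enc_le: "set_encode A \<le> set_encode {1..<m}" if "A \<in> ?P - {?T}" for A
  proof -
    have "set_encode A \<le> set_encode ?T"
      unfolding set_encode_def using that by (intro sum_mono2) auto
    moreover have "set_encode A \<noteq> set_encode ?T" using that finA by (simp add: set_encode_eq)
    ultimately show ?thesis using encT by simp
  qed
  have T'R: "{1..<m} \<in> R" using m atLeast1_lessThan_neq[of m] by (simp add: R_def subset_eq)
  then have N0: "0 < N" using finR by (auto simp: N_def card_gt_0_iff)
  have s0: "s 0 = {1..<m}"
  proof -
    obtain j where j: "j < N" "s j = {1..<m}" using sinv[OF T'R] by blast
    have "set_encode (s 0) \<le> set_encode (s j)" using enc_le sR[OF N0] j by (simp add: R_def)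
    then have "j = 0" using s(2)[of 0 j] j(1) by (cases "j = 0") auto
    then show ?thesis using j by simp
  qed
  \<comment> \<open>The last set is linked to the empty set, where its coefficient is near 1; this
    is why \<open>small\<close> excludes \<open>{}\<close>.\<close>
  define J where "J p = (if Suc p < N then s (Suc p) else {})" for p
  have J: "J p \<in> ?P" for p using sR[of "Suc p"] by (auto simp: J_def R_def)
  have encJ: "set_encode (J p) < set_encode (s p)" if "p < N" for p
  proof (cases "Suc p < N")
    case False
    have "s p \<in> R" using sR that by blast
    then have "s p \<noteq> {}" "finite (s p)" using finA by (auto simp: R_def)
    then show ?thesis using False set_encode_eq[of "s p" "{}"] by (simp add: J_def)
  qed (use s(2) in \<open>auto simp: J_def\<close>)
  define \<Phi> where "\<Phi> p G \<longleftrightarrow> (\<forall>U. G U \<noteq> 0 \<longrightarrow> U \<subseteq> J p \<union> s p \<and> set_encode U \<le> set_encode (s p)) \<and>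
    G (s p) = - (2 / 2 ^ card (s p)) \<and> G (J p) = 1 - 2 / 2 ^ card (s p) \<and>
    (\<forall>U. U \<noteq> J p \<longrightarrow> \<bar>G U\<bar> \<le> 2 / 2 ^ card (s p)) \<and> (\<forall>U. G U \<in> \<rat>) \<and>
    (\<forall>X\<in>?P. (\<Sum>U\<in>?P. G U * chi U X) \<in> {-1, 1 :: real})" for p and G :: "nat set \<Rightarrow> real"
  have "\<exists>G. \<Phi> p G" if p: "p < N" for p
  proof -
    have fin: "finite (s p)" "finite (J p)" and sub: "J p \<union> s p \<subseteq> ?T"
      using sR[OF p] J[of p] finA[of "s p"] finA[of "J p"] by (auto simp: R_def)
    obtain G where G: "\<And>U. G U \<noteq> 0 \<Longrightarrow> U \<subseteq> J p \<union> s p \<and> set_encode U \<le> set_encode (s p)"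
      "G (s p) = - (2 / 2 ^ card (s p))" "G (J p) = 1 - 2 / 2 ^ card (s p)"
      "\<And>U. U \<noteq> J p \<Longrightarrow> \<bar>G U\<bar> \<le> 2 / 2 ^ card (s p)" "\<And>U. G U \<in> \<rat>"
      "\<And>X M. finite X \<Longrightarrow> finite M \<Longrightarrow> J p \<union> s p \<subseteq> M \<Longrightarrow> (\<Sum>U\<in>Pow M. G U * chi U X) \<in> {-1, 1 :: real}"
      using spike_function[OF fin encJ[OF p]] by blast
    have "(\<Sum>U\<in>?P. G U * chi U X) \<in> {-1, 1 :: real}" if "X \<in> ?P" for X
      using G(6)[OF finA[OF that] _ sub] by simp
    then have "\<Phi> p G" unfolding \<Phi>_def using G(1-5) by blast
    then show ?thesis by blast
  qed
  then have "\<exists>G. \<forall>p\<in>{..<N}. \<Phi> p (G p)" by (intro bchoice) auto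
  then obtain G where G_\<Phi>: "\<And>p. p < N \<Longrightarrow> \<Phi> p (G p)" by auto
  have G: "\<And>U. G p U \<noteq> 0 \<Longrightarrow> U \<subseteq> J p \<union> s p \<and> set_encode U \<le> set_encode (s p)"
    "G p (s p) = - (2 / 2 ^ card (s p))"
    "G p (J p) = 1 - 2 / 2 ^ card (s p)"
    "\<And>U. U \<noteq> J p \<Longrightarrow> \<bar>G p U\<bar> \<le> 2 / 2 ^ card (s p)"
    "\<And>U. G p U \<in> \<rat>"
    "\<And>X. X \<in> ?P \<Longrightarrow> (\<Sum>U\<in>?P. G p U * chi U X) \<in> {-1, 1 :: real}" if "p < N" for p
    using G_\<Phi>[OF that] unfolding \<Phi>_def by blast+
  define idx where "idx A = inv_into {..<N} s A" for A
  have idx: "idx A < N" "s (idx A) = A" if "A \<in> R" for A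
    using inv_into_into[of A s "{..<N}"] f_inv_into_f[of A s "{..<N}"] s(1) that
    by (auto simp: idx_def bij_betw_def)
  have idx_s: "idx (s p) = p" if "p < N" for p
    using s(1) that by (simp add: idx_def bij_betw_def)
  define F where "F A U = (if A \<in> R then G (idx A) U else if A = ?T then of_bool (U = {1..<m}) else of_bool (U = A))"
    for A U
  have Fs: "F (s p) U = G p U" if "p < N" for p U using that sR idx_s by (simp add: F_def)
  have TR: "?T \<notin> R" by (simp add: R_def)
  have sumT: "(\<Sum>U\<in>?P. of_bool (U = A) * chi U X) = (chi A X :: real)" if "A \<in> ?P" for A X
  proof -
    have "(\<Sum>U\<in>?P. of_bool (U = A) * chi U X) = (\<Sum>U\<in>?P. if U = A then chi U X else 0 :: real)"
      by (intro sum.cong) auto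
    then show ?thesis using that by simp
  qed
  have "spike_system m N s F"
  proof
    show "bij_betw s {..<N} {A \<in> ?P - {?T}. 3 \<le> card A}" using s(1) by (simp add: R_def)
    show "F ?T U = of_bool (U = {1..<m})" for U using TR by (simp add: F_def)
    show "F A U = of_bool (U = A)" if "A \<in> ?P" "card A < 3" for A U
      using that m by (auto simp: F_def R_def)
    show "U \<in> ?P - {?T} \<and> set_encode U \<le> set_encode A" if A: "A \<in> ?P - {?T}" and U: "F A U \<noteq> 0" for A U
    proof (cases "A \<in> R")
      case True
      have "F A U = G (idx A) U" using True by (simp add: F_def)
      then have "U \<subseteq> J (idx A) \<union> A \<and> set_encode U \<le> set_encode A"
        using G(1)[OF idx(1)[OF True]] idx(2)[OF True] U by metis
      moreover from this have "U \<noteq> ?T" using enc_le[OF A] encT by auto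
      ultimately show ?thesis using J[of "idx A"] A by blast
    next
      case False
      then show ?thesis using A U by (auto simp: F_def split: if_splits)
    qed
    show "F (s p) (s p) = - (2 / 2 ^ card (s p))" if "p < N" for p using that G(2) Fs by simp
    show "F (s p) (s (Suc p)) = 1 - 2 / 2 ^ card (s p)" if "Suc p < N" for p
      using that G(3)[of p] Fs[of p] by (simp add: J_def)
    show "\<bar>F (s p) U\<bar> \<le> 2 / 2 ^ card (s p)" if "p < N" "Suc p < N \<Longrightarrow> U \<noteq> s (Suc p)" "U \<noteq> {}" for p U
      using that G(4)[of p U] Fs[of p] by (simp add: J_def split: if_splits)
    show "F A U \<in> \<rat>" for A U using G(5) idx(1) by (auto simp: F_def of_bool_def)
    show "(\<Sum>U\<in>?P. F A U * chi U X) \<in> {-1, 1}" if A: "A \<in> ?P" and X: "X \<in> ?P" for A X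
    proof (cases "A \<in> R")
      case True
      then show ?thesis using G(6)[OF idx(1)[OF True] X] by (simp add: F_def)
    next
      case False
      define B where "B = (if A = ?T then {1..<m} else A)"
      have "F A U = of_bool (U = B)" for U using False by (simp add: F_def B_def)
      moreover have "B \<in> ?P" using A by (auto simp: B_def)
      ultimately show ?thesis using chi_pm1[of B X, where 'a=real] sumT[of B X] by simp
    qed
  qed (use m s s0 N0 in auto)
  then show ?thesis by blast
qed

section \<open>Linear relations in the system and the size of their coefficients\<close>

context spike_system
begin

abbreviation "P \<equiv> Pow {..<m}"

text \<open>The Boolean function with Fourier transform \<open>F A\<close>, made integer-valued for
  the doubling. On \<open>P\<close> the tested sum is 1 or -1 by \<open>bool\<close>, so the value
  -1 of the second branch is correct.\<close>

definition spike_fun :: "nat set \<Rightarrow> nat set \<Rightarrow> int" where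
  "spike_fun A X = (if (\<Sum>U\<in>P. F A U * chi U X) = 1 then 1 else -1)"

lemma spike_fun_pm1: "spike_fun A X \<in> {-1, 1}"
  by (simp add: spike_fun_def)

lemma of_int_spike_fun: "A \<in> P \<Longrightarrow> X \<in> P \<Longrightarrow> of_int (spike_fun A X) = (\<Sum>U\<in>P. F A U * chi U X)"
  using bool[of A X] by (auto simp: spike_fun_def)

lemma relation_expansion:
  assumes "X \<in> P"
  shows "of_int (\<Sum>A\<in>P. c A * spike_fun A X) = (\<Sum>U\<in>P. (\<Sum>A\<in>P. of_int (c A) * F A U) * chi U X)"
proof -
  have "of_int (\<Sum>A\<in>P. c A * spike_fun A X) = (\<Sum>A\<in>P. \<Sum>U\<in>P. of_int (c A) * F A U * chi U X)"
    using assms by (simp add: of_int_spike_fun sum_distrib_left mult.assoc del: Pow_iff)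
  also have "\<dots> = (\<Sum>U\<in>P. \<Sum>A\<in>P. of_int (c A) * F A U * chi U X)" by (rule sum.swap)
  finally show ?thesis by (simp add: sum_distrib_right)
qed

lemma s_mem: "p < N \<Longrightarrow> s p \<in> P" "p < N \<Longrightarrow> s p \<noteq> {..<m}" "p < N \<Longrightarrow> 3 \<le> card (s p)"
  using bij_betwE[OF bij] by auto

lemma s_eq_iff: "p < N \<Longrightarrow> q < N \<Longrightarrow> s p = s q \<longleftrightarrow> p = q"
  using bij by (auto simp: bij_betw_def inj_on_def)

lemma s_surj:
  assumes "A \<in> P" "A \<noteq> {..<m}" "3 \<le> card A"
  obtains p where "p < N" "A = s p"
proof -
  have "A \<in> s ` {..<N}" unfolding bij_betw_imp_surj_on[OF bij] using assms by simp
  then show ?thesis using that by auto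
qed

lemma F_diag_nonzero:
  assumes "A \<in> P - {{..<m}}"
  shows "F A A \<noteq> 0"
proof (cases "3 \<le> card A")
  case True
  then obtain p where "p < N" "A = s p" using s_surj assms by blast
  then show ?thesis using diag by simp
qed (use low[of A A] assms in auto)

text \<open>The rows other than the top one form a triangular system, so they combine rationally to
  minus the character of \<open>{1..<m}\<close>, which is the top function. Clearing denominators
  leaves the coefficient \<open>D\<close> at the top set.\<close>

lemma relation_exists:
  "\<exists>c. (\<exists>A\<in>P. c A \<noteq> 0) \<and> (\<forall>X\<in>P. (\<Sum>A\<in>P. c A * spike_fun A X) = 0)"
proof -
  let ?Q = "P - {{..<m}}"
  have "\<exists>b. (\<forall>A. b A \<in> \<rat>) \<and> (\<forall>U. - of_bool (U = {1..<m}) = (\<Sum>A\<in>?Q. b A * F A U))"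
  proof (rule triangular_rational_solution)
    show "U \<in> ?Q \<and> set_encode U \<le> set_encode A" if "A \<in> ?Q" "F A U \<noteq> 0" for A U
      using supp that by blast
    show "F A A \<noteq> 0" if "A \<in> ?Q" for A using F_diag_nonzero that .
    show "U \<in> ?Q" if "- of_bool (U = {1..<m}) \<noteq> (0::real)" for U
      using that m atLeast1_lessThan_neq[of m] by (simp add: subset_eq split: if_splits)
  qed (auto simp: rat of_bool_def intro: finite_subset)
  then obtain b where b: "\<And>A. b A \<in> \<rat>" "\<And>U. - of_bool (U = {1..<m}) = (\<Sum>A\<in>?Q. b A * F A U)"
    by blast
  obtain D :: int where D: "D \<noteq> 0" "\<And>A. A \<in> ?Q \<Longrightarrow> of_int D * b A \<in> \<int>"
    using common_denominator[of ?Q b] b(1) by auto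
  \<comment> \<open>The floor is exact, since \<open>of_int D * b A\<close> is an integer.\<close>
  define c where "c A = (if A = {..<m} then D else \<lfloor>of_int D * b A\<rfloor>)" for A
  have c: "of_int (c A) = of_int D * b A" if "A \<in> ?Q" for A
    using D(2)[OF that] that by (simp add: c_def)
  have "(\<Sum>A\<in>P. of_int (c A) * F A U) = 0" for U
  proof -
    have "(\<Sum>A\<in>P. of_int (c A) * F A U)
        = of_int (c {..<m}) * F {..<m} U + (\<Sum>A\<in>?Q. of_int (c A) * F A U)"
      by (rule sum.remove) auto
    also have "(\<Sum>A\<in>?Q. of_int (c A) * F A U) = of_int D * (\<Sum>A\<in>?Q. b A * F A U)"
      unfolding sum_distrib_left by (intro sum.cong refl) (simp only: c mult.assoc)
    finally show ?thesis by (simp add: b(2)[symmetric] top c_def)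
  qed
  then have "of_int (\<Sum>A\<in>P. c A * spike_fun A X) = (0::real)" if "X \<in> P" for X
    using relation_expansion[OF that] by simp
  then have "\<forall>X\<in>P. (\<Sum>A\<in>P. c A * spike_fun A X) = 0" by (simp only: of_int_eq_0_iff) simp
  moreover have "\<exists>A\<in>P. c A \<noteq> 0" using D(1) by (intro bexI[of _ "{..<m}"]) (auto simp: c_def)
  ultimately show ?thesis by blast
qed

text \<open>By independence of the characters every column vanishes. Triangularity rules out a zero
  top coefficient: the largest set with nonzero coefficient would be alone in its own column. Column
  \<open>s 0\<close> then gives the start of the growth along the chain of the
  \<open>s p\<close>.\<close>

lemma relation_large:
  assumes nz: "\<exists>A\<in>P. c A \<noteq> 0" and rel: "\<forall>X\<in>P. (\<Sum>A\<in>P. c A * spike_fun A X) = 0"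
  shows "(\<Prod>p<N. 2 ^ (card (s p) - 2)) \<le> (\<Sum>A\<in>P. \<bar>c A\<bar>)"
proof -
  let ?T = "{..<m}"
  have z: "(\<Sum>A\<in>P. of_int (c A) * F A U) = 0" if "U \<in> P" for U
  proof (rule chi_independent[where y = "\<lambda>U. \<Sum>A\<in>P. of_int (c A) * F A U"])
    show "(\<Sum>V\<in>P. (\<Sum>A\<in>P. of_int (c A) * F A V) * chi V X) = 0" if "X \<subseteq> {..<m}" for X
      using relation_expansion[of X c] rel that by simp
    show "U \<subseteq> {..<m}" using that by simp
  qed
  have cT: "c ?T \<noteq> 0"
  proof
    assume c0: "c ?T = 0"
    obtain A where A: "A \<in> P" "c A \<noteq> 0" "\<And>B. B \<in> P \<Longrightarrow> c B \<noteq> 0 \<Longrightarrow> set_encode B \<le> set_encode A"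
    proof -
      let ?K = "{A \<in> P. c A \<noteq> 0}"
      have fin: "finite (set_encode ` ?K)" "set_encode ` ?K \<noteq> {}" using nz by auto
      obtain A where "A \<in> ?K" "Max (set_encode ` ?K) = set_encode A" using Max_in[OF fin] by auto
      then show thesis using Max_ge[OF fin(1)] by (intro that[of A]) auto
    qed
    have AT: "A \<noteq> ?T" using c0 A by auto
    have "(\<Sum>B\<in>P. of_int (c B) * F B A) = (\<Sum>B\<in>{A}. of_int (c B) * F B A)"
    proof (rule sum.mono_neutral_right)
      show "\<forall>B\<in>P - {A}. of_int (c B) * F B A = 0"
      proof
        fix B assume B: "B \<in> P - {A}"
        have "F B A = 0" if "c B \<noteq> 0"
        proof (rule ccontr)
          assume "F B A \<noteq> 0"
          then have "set_encode A \<le> set_encode B" using supp[of B A] B that c0 by blast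
          then have "set_encode A = set_encode B" using A(3)[of B] B that by simp
          then show False using B A(1) set_encode_eq[of A B] finite_subset[of _ "{..<m}"] by auto
        qed
        then show "of_int (c B) * F B A = 0" by auto
      qed
    qed (use A in auto)
    then show False using z[OF A(1)] A F_diag_nonzero[of A] AT by simp
  qed
  have main: "(\<Prod>q<N - 1. 2 ^ (card (s q) - 2)) \<le> \<bar>real_of_int (c (s (N - 1)))\<bar> * (2 / 2 ^ card (s (N - 1)))"
  proof (rule conjunct1[OF coefficient_growth[where G = "\<lambda>q p. F (s q) (s p)" and N = N
          and c = "\<lambda>p. real_of_int (c (s p))" and k = "\<lambda>p. card (s p)"]])
    show "3 \<le> card (s p)" if "p < N" for p using s_mem(3) that .
    show "\<bar>F (s p) (s p)\<bar> = 2 / 2 ^ card (s p)" if "p < N" for p using diag that by simp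
    show "F (s p) (s (Suc p)) = 1 - 2 / 2 ^ card (s p)" if "Suc p < N" for p using link that .
    show "\<bar>F (s q) (s (Suc p))\<bar> \<le> 2 / 2 ^ card (s q)" if "q < p" "Suc p < N" for p q
      using that s_mem(3)[of "Suc p"] by (intro small) (auto simp: s_eq_iff)
    show "(\<Sum>q\<le>Suc p. real_of_int (c (s q)) * F (s q) (s (Suc p))) = 0" if p: "Suc p < N" for p
    proof -
      have inj: "inj_on s {..Suc p}" using bij p by (auto simp: bij_betw_def intro: inj_on_subset)
      have "(\<Sum>q\<le>Suc p. real_of_int (c (s q)) * F (s q) (s (Suc p)))
          = (\<Sum>A\<in>s ` {..Suc p}. real_of_int (c A) * F A (s (Suc p)))"
        by (simp add: sum.reindex[OF inj])
      \<comment> \<open>All other rows vanish in this column: the top row meets only column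
        \<open>s 0\<close>, small sets only their own, and later sets only columns of smaller
        code.\<close>
      also have "\<dots> = (\<Sum>A\<in>P. real_of_int (c A) * F A (s (Suc p)))"
      proof (rule sum.mono_neutral_left)
        show "s ` {..Suc p} \<subseteq> P"
        proof (rule image_subsetI)
          show "s q \<in> P" if "q \<in> {..Suc p}" for q using s_mem(1)[of q] p that by simp
        qed
        show "\<forall>A\<in>P - s ` {..Suc p}. real_of_int (c A) * F A (s (Suc p)) = 0"
        proof
          fix A assume A: "A \<in> P - s ` {..Suc p}"
          consider "A = ?T" | "A \<noteq> ?T" "card A < 3" | "A \<noteq> ?T" "3 \<le> card A" by linarith
          then have "F A (s (Suc p)) = 0"
          proof cases
            case 1
            have "s (Suc p) \<noteq> s 0" using s_eq_iff[of "Suc p" 0] p by simp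
            then show ?thesis using 1 top s0(2) by simp
          next
            case 2
            then show ?thesis using low[of A] A by auto
          next
            case 3
            then obtain q where q: "q < N" "A = s q" using s_surj A by blast
            then have "Suc p < q" using A by (auto simp: not_less)
            then show ?thesis using decr[of "Suc p" q] q supp[of A "s (Suc p)"] A 3 by fastforce
          qed
          then show "real_of_int (c A) * F A (s (Suc p)) = 0" by simp
        qed
      qed simp
      also have "\<dots> = 0" using z s_mem(1)[OF p] by blast
      finally show ?thesis .
    qed
    show "1 \<le> \<bar>real_of_int (c (s 0)) * F (s 0) (s 0)\<bar>"
    proof -
      have ne: "s 0 \<noteq> ?T" "s 0 \<in> P" using s_mem s0(1) by auto
      have "(\<Sum>A\<in>{?T, s 0}. real_of_int (c A) * F A (s 0)) = (\<Sum>A\<in>P. real_of_int (c A) * F A (s 0))"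
      proof (rule sum.mono_neutral_left)
        show "\<forall>A\<in>P - {?T, s 0}. real_of_int (c A) * F A (s 0) = 0"
        proof
          fix A assume A: "A \<in> P - {?T, s 0}"
          have "F A (s 0) = 0"
          proof (cases "3 \<le> card A")
            case True
            then obtain q where q: "q < N" "A = s q" using s_surj A by blast
            then have "0 < q" using A by (cases q) auto
            then show ?thesis using decr[of 0 q] q supp[of A "s 0"] A by fastforce
          qed (use low[of A] A in auto)
          then show "real_of_int (c A) * F A (s 0) = 0" by simp
        qed
      qed (use ne in auto)
      also have "\<dots> = 0" using z ne(2) .
      finally have "real_of_int (c (s 0)) * F (s 0) (s 0) = - real_of_int (c ?T)"
        using ne(1) s0(2) by (simp add: top)
      then show ?thesis using cT by simp
    qed
    show "N - 1 < N" using s0(1) by simp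
  qed
  let ?k = "card (s (N - 1))"
  have k: "3 \<le> ?k" using s_mem(3)[of "N - 1"] s0(1) by simp
  \<comment> \<open>Growth yields the factors before the last; the last one is absorbed by the
    weight \<open>2 / 2 ^ ?k\<close>, since their product is 1/2.\<close>
  have "(\<Prod>p<N. 2 ^ (card (s p) - 2)) = (\<Prod>p<N - 1. 2 ^ (card (s p) - 2)) * (2 ^ (?k - 2) :: real)"
    using prod.lessThan_Suc[of "\<lambda>p. 2 ^ (card (s p) - 2) :: real" "N - 1"] s0(1) by simp
  also have "\<dots> \<le> \<bar>real_of_int (c (s (N - 1)))\<bar> * (2 / 2 ^ ?k) * 2 ^ (?k - 2)"
    using main by (intro mult_right_mono) auto
  also have "\<dots> \<le> \<bar>real_of_int (c (s (N - 1)))\<bar>"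
  proof -
    have "2 + (?k - 2) = ?k" using k by simp
    then have "(2::real) ^ ?k = 2 ^ 2 * 2 ^ (?k - 2)" by (metis power_add)
    then have "2 / 2 ^ ?k * 2 ^ (?k - 2) \<le> (1::real)" by simp
    then show ?thesis
      using mult_left_mono[of "2 / 2 ^ ?k * 2 ^ (?k - 2)" 1 "\<bar>real_of_int (c (s (N - 1)))\<bar>"]
      by (simp only: mult.assoc abs_ge_zero mult_1_right)
  qed
  also have "\<dots> = real_of_int \<bar>c (s (N - 1))\<bar>" by simp
  finally have "real_of_int (\<Prod>p<N. 2 ^ (card (s p) - 2)) \<le> real_of_int \<bar>c (s (N - 1))\<bar>" by simp
  then have "(\<Prod>p<N. 2 ^ (card (s p) - 2)) \<le> \<bar>c (s (N - 1))\<bar>" by (simp only: of_int_le_iff)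
  also have "\<dots> \<le> (\<Sum>A\<in>P. \<bar>c A\<bar>)"
    using s_mem(1)[of "N - 1"] s0(1) by (intro member_le_sum) auto
  finally show ?thesis .
qed

text \<open>Against the sum of all \<open>card A\<close>, each set loses at most 2, by the
  subtraction or by being too small, and the top set loses \<open>m\<close>, at most
  \<open>2 ^ m\<close>. The loss of \<open>3 * 2 ^ m\<close> appears doubled.\<close>

lemma exponent_bound: "m * 2 ^ m \<le> 2 * (\<Sum>p<N. card (s p) - 2) + 6 * 2 ^ m"
proof -
  define R where "R = {A \<in> P - {{..<m}}. 3 \<le> card A}"
  have "(\<Sum>p<N. card (s p) - 2) = (\<Sum>A\<in>R. card A - 2)"
    using sum.reindex_bij_betw[OF bij, of "\<lambda>A. card A - 2"] by (simp add: R_def)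
  also have "\<dots> = (\<Sum>A\<in>P. if A \<in> R then card A - 2 else 0)"
    by (subst sum.inter_restrict[symmetric]) (auto simp: R_def intro!: sum.cong)
  finally have R: "(\<Sum>p<N. card (s p) - 2) = (\<Sum>A\<in>P. if A \<in> R then card A - 2 else 0)" .
  have "(\<Sum>A\<in>P. card A) \<le> (\<Sum>A\<in>P. (if A \<in> R then card A - 2 else 0) + 2 + (if A = {..<m} then m else 0))"
    by (intro sum_mono) (auto simp: R_def)
  also have "\<dots> = (\<Sum>p<N. card (s p) - 2) + 2 * 2 ^ m + m"
    unfolding sum.distrib R by (simp add: card_Pow)
  finally have "(\<Sum>A\<in>P. card A) \<le> (\<Sum>p<N. card (s p) - 2) + 2 * 2 ^ m + m" .
  moreover have "m \<le> 2 ^ m" by (simp add: less_imp_le less_exp)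
  ultimately show ?thesis using sum_card_Pow[of m] by linarith
qed

lemma power_le_tau_pm1: "2 ^ (\<Sum>p<N. card (s p) - 2) \<le> tau_pm1 (2 * 2 ^ m)"
proof -
  obtain c where c: "\<exists>A\<in>P. c A \<noteq> 0" "\<forall>X\<in>P. (\<Sum>A\<in>P. c A * spike_fun A X) = 0"
    using relation_exists by blast
  show ?thesis
  proof (rule le_tau_pm1_doubled[where f = spike_fun and c = c])
    show "int (2 ^ (\<Sum>p<N. card (s p) - 2)) \<le> (\<Sum>A\<in>P. \<bar>c A\<bar>)"
      if "\<exists>A\<in>P. c A \<noteq> 0" "\<forall>X\<in>P. (\<Sum>A\<in>P. c A * spike_fun A X) = 0" for c
      using relation_large[OF that] by (simp add: power_sum)
    show "spike_fun A X \<in> {-1, 1}" for A X by (rule spike_fun_pm1)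
  qed (fact c)+
qed

end

theorem theorem3:
  shows "\<exists>c>0. \<forall>d::nat. (\<exists>m::nat. d = 2 ^ m) \<longrightarrow>
           real (tau_pm1 d) \<ge> (c * real d) powr (real d / 4)"
proof (intro exI[of _ "1 / 128"] conjI allI impI)
  fix d :: nat
  assume "\<exists>m::nat. d = 2 ^ m"
  then obtain k where k: "d = 2 ^ k" by blast
  \<comment> \<open>With \<open>d = 2 ^ Suc m\<close> the exponent bound reads
    \<open>(m - 6) * (d / 4)\<close>, and \<open>2 powr (m - 6)\<close> is \<open>d / 128\<close>.
    For \<open>d\<close> up to 128 the base is at most 1.\<close>
  show "(1 / 128 * real d) powr (real d / 4) \<le> real (tau_pm1 d)"
  proof (cases "k \<le> 7")
    case True
    have "(2::real) ^ k \<le> 2 ^ 7" using True by (intro power_increasing) auto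
    then have "real d \<le> 128" using k by simp
    then have "(1 / 128 * real d) powr (real d / 4) \<le> 1" by (intro powr_le1) auto
    also have "\<dots> \<le> real (tau_pm1 d)" using two_le_tau_pm1[of d] by simp
    finally show ?thesis .
  next
    case False
    define m where "m = k - 1"
    have km: "k = Suc m" "4 \<le> m" using False by (auto simp: m_def)
    obtain N s F where "spike_system m N s F" using spike_system_exists[OF km(2)] by blast
    then interpret spike_system m N s F .
    define E where "E = (\<Sum>p<N. card (s p) - 2)"
    have "real (m * 2 ^ m) \<le> real (2 * E + 6 * 2 ^ m)"
      using exponent_bound unfolding E_def by (simp only: of_nat_le_iff)
    then have E: "(real m - 6) * (real d / 4) \<le> real E" unfolding k km(1) by (simp add: algebra_simps)
    have "1 / 128 * real d = 2 powr (real m - 6)"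
      unfolding k km(1) by (simp add: powr_diff powr_realpow)
    then have "(1 / 128 * real d) powr (real d / 4) = 2 powr ((real m - 6) * (real d / 4))"
      by (simp only: powr_powr)
    also have "\<dots> \<le> 2 powr real E" using E by (intro powr_mono) auto
    also have "\<dots> = real (2 ^ E)" by (simp add: powr_realpow)
    also have "\<dots> \<le> real (tau_pm1 d)"
      using power_le_tau_pm1 k km(1) unfolding E_def by (simp only: of_nat_le_iff power_Suc)
    finally show ?thesis .
  qed
qed simp

end
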